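(* Let $K$ be an algebraically closed field of characteristic $p\ge 0$ and let $(x(t),y(t))$ be a (primitive) parameterization of a plane branch over $K$ with semigroup $\Gamma$ and conductor $c$. Let $a:=\mathrm{ord}_t(x(t))<b:=\mathrm{ord}_t(y(t))$. In each of the following statements the coefficients $a_i,b_i$ are suitable elements of $K$, sums $\sum a_it^i$ are over $i>a$ and sums $\sum b_it^i$ are over $i>b$, with the further index restrictions indicated. (1) In general, $(x(t),y(t))\sim_{\mathcal A}\bigl(t^a+\sum_{i\notin\Gamma}a_it^i,\;t^b+\sum_{i\notin\Gamma}b_it^i\bigr)$ and $a\nmid b$. If $p\nmid a$ then $(x(t),y(t))\sim_{\mathcal A}\bigl(t^a,\;t^b+\sum_{i\notin\Gamma}b_it^i\bigr)$. If $p\nmid b$ then $(x(t),y(t))\sim_{\mathcal A}\bigl(t^a+\sum_{i\notin\Gamma}a_it^i,\;t^b\bigr)$. (2) Let $a>2$. If $p\nmid b$ then $(x(t),y(t))\sim_{\mathcal A}\bigl(t^a+\sum_{i\notin\Gamma}a_it^i,\;t^b+\sum_{i\notin\Gamma,\,i<c-1}b_it^i\bigr)$. Similarly, if $p\nmid a$ then $(x(t),y(t))\sim_{\mathcal A}\bigl(t^a+\sum_{i\notin\Gamma,\,i<c-1}a_it^i,\;t^b+\sum_{i\notin\Gamma}b_it^i\bigr)$. (3) If $a>2$, $p\nmid a$ and $p\nmid b$, then $(x(t),y(t))\sim_{\mathcal A}\bigl(t^a,\;t^b+\sum_{i\notin\Gamma,\,i<c-1}b_it^i\bigr)\sim_{\mathcal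 A}\bigl(t^a+\sum_{i\notin\Gamma,\,i<c-1}a_it^i,\;t^b\bigr)$.
   Context: A parameterization of a plane branch over $K$ is a nonzero pair $\psi=(x(t),y(t))\in (tK[[t]])^2$; it is primitive if $\dim_K K[[t]]/K[[x(t),y(t)]]<\infty$ (always assumed). Its semigroup is $\Gamma=\{\mathrm{ord}_t(h)\mid 0\ne h\in K[[x(t),y(t)]]\}$ and its conductor is $c=\min\{n\in\Gamma\mid n+m\in\Gamma\ \forall m\ge0\}$. Two parameterizations $\psi,\phi$ are $\mathcal A$-equivalent ($\psi\sim_{\mathcal A}\phi$) if there are $r\in tK[[t]]$ with $r'(0)\ne0$ and $L_1,L_2\in\langle x,y\rangle K[[x,y]]$ with invertible linear part such that $\phi(t)=(L_1(\psi(r(t))),L_2(\psi(r(t))))$. By convention $p=0$ divides no integer.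
   Formalization: As stated, "a∤b" fails if a | ord y, e.g. (t^2,t^4+t^5), or a=1. Here b>a is asserted to exist: it equals ord y if y≠0 and a∤ord y or a=1, otherwise it is a normalised order; all forms hold with this b, and a∤b is claimed only for a≠1. *)

theory Defs
  imports "HOL-Computational_Algebra.Computational_Algebra"
begin

text \<open>
  An element \<open>F\<close> of \<open>K[[X,Y]]\<close> is a power series in \<open>Y\<close> over \<open>K[[X]]\<close>:
  \<open>F $ j $ i\<close> is the coefficient of \<open>X^i Y^j\<close>.
\<close>

text \<open>
  Substitution \<open>F(x(t), y(t))\<close>. It is meant for \<open>x\<close>, \<open>y\<close> with zero constant term; then
  \<open>x^i y^j\<close> has order at least \<open>i + j\<close>, so cutting off at \<open>i, j \<le> n\<close> loses nothing in degree \<open>n\<close>.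
\<close>
definition subst2 :: "'k::field fps fps \<Rightarrow> 'k fps \<times> 'k fps \<Rightarrow> 'k fps" where
  "subst2 F \<psi> = Abs_fps (\<lambda>n. \<Sum>j\<le>n. \<Sum>i\<le>n. F $ j $ i * (fst \<psi> ^ i * snd \<psi> ^ j) $ n)"

definition branch_ring :: "'k::field fps \<times> 'k fps \<Rightarrow> 'k fps set" where
  "branch_ring \<psi> = range (\<lambda>F. subst2 F \<psi>)"

definition parameterization :: "'k::field fps \<times> 'k fps \<Rightarrow> bool" where
  "parameterization \<psi> \<longleftrightarrow> fst \<psi> $ 0 = 0 \<and> snd \<psi> $ 0 = 0 \<and> \<psi> \<noteq> (0, 0)"

text \<open>
  \<open>dim\<^sub>K K[[t]]/R < \<infinity>\<close> for the subspace \<open>R = branch_ring \<psi>\<close>: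
  the classes of finitely many power series span the quotient.
\<close>
definition primitive :: "'k::field fps \<times> 'k fps \<Rightarrow> bool" where
  "primitive \<psi> \<longleftrightarrow> (\<exists>B. finite B \<and>
     (\<forall>f. \<exists>l. f - (\<Sum>g\<in>B. fps_const (l g) * g) \<in> branch_ring \<psi>))"

definition semigroup_of :: "'k::field fps \<times> 'k fps \<Rightarrow> nat set" where
  "semigroup_of \<psi> = {subdegree h | h. h \<in> branch_ring \<psi> \<and> h \<noteq> 0}"

definition conductor :: "nat set \<Rightarrow> nat" where
  "conductor \<Gamma> = (LEAST n. n \<in> \<Gamma> \<and> (\<forall>m. n + m \<in> \<Gamma>))"

text \<open>Automorphisms \<open>(X, Y) \<mapsto> (L1, L2)\<close> of \<open>K[[X,Y]]\<close>: no constant terms, invertible Jacobian matrix at 0.\<close>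
definition coord_change :: "'k::field fps fps \<Rightarrow> 'k fps fps \<Rightarrow> bool" where
  "coord_change L1 L2 \<longleftrightarrow> L1 $ 0 $ 0 = 0 \<and> L2 $ 0 $ 0 = 0 \<and>
     L1 $ 0 $ 1 * L2 $ 1 $ 0 - L1 $ 1 $ 0 * L2 $ 0 $ 1 \<noteq> 0"

definition A_equiv :: "'k::field fps \<times> 'k fps \<Rightarrow> 'k fps \<times> 'k fps \<Rightarrow> bool"  (infix "\<sim>\<^sub>A" 50) where
  "\<psi> \<sim>\<^sub>A \<phi> \<longleftrightarrow> (\<exists>r L1 L2. r $ 0 = 0 \<and> r $ 1 \<noteq> 0 \<and> coord_change L1 L2 \<and>
     \<phi> = (subst2 L1 (fst \<psi> oo r, snd \<psi> oo r), subst2 L2 (fst \<psi> oo r, snd \<psi> oo r)))"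

text \<open>The series \<open>\<Sum>i\<in>I. \<alpha>\<^sub>i t^i\<close>, for a possibly infinite set \<open>I\<close> of exponents.\<close>
definition series_on :: "nat set \<Rightarrow> (nat \<Rightarrow> 'k::field) \<Rightarrow> 'k fps" where
  "series_on I \<alpha> = Abs_fps (\<lambda>i. if i \<in> I then \<alpha> i else 0)"

text \<open>
  In the theorem on normal forms of a branch \<open>(x, y)\<close> with \<open>a = ord x < ord y\<close>, the order \<open>b\<close>
  of the second component is read as normalised: it is \<open>ord y\<close> whenever \<open>a\<close> does not divide
  \<open>ord y\<close>, and otherwise the order obtained after subtracting powers of the first component
  from the second. In the smooth case \<open>a = 1\<close> the assertion that \<open>a\<close> does not divide \<open>b\<close> is dropped
  and \<open>b = ord y\<close> (any \<open>b > 1\<close> if \<open>y = 0\<close>). For \<open>p = 0\<close> the conditions \<open>\<not> p dvd a\<close> and \<open>\<not> p dvd b\<close>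
  hold automatically, as \<open>a, b > 0\<close>.
\<close>

end

theory Submission
  imports Defs
begin

text \<open>
  Write \<open>R = K[[x, y]]\<close> for the ring of the branch and \<open>\<Gamma>\<close> for its semigroup of orders. Everything
  rests on two facts about \<open>R\<close>.

  The first is completeness. Finite codimension makes \<open>\<Gamma>\<close> cofinite, so there is a conductor \<open>c\<close>,
  and multiplying finitely many elements of orders \<open>c, \<dots>, c + a - 1\<close> by power series in \<open>x\<close> produces
  \<^emph>\<open>every\<close> power series of order at least \<open>c\<close> (\<open>tail_in_ring\<close>). Hence any series can be freed of all
  its terms with exponent in \<open>\<Gamma>\<close> by subtracting an element \<open>h = H(x, y)\<close> of \<open>R\<close> (\<open>reduce\<close>). If \<open>h\<close> has
  order greater than \<open>a = ord x\<close>, then \<open>H\<close> contains no term \<open>X\<close>; if it has order greater than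
  \<open>b = ord y\<close>, where \<open>a\<close> does not divide \<open>b\<close>, then \<open>H\<close> contains no term \<open>Y\<close> (\<open>no_X_term\<close>, \<open>no_Y_term\<close>).
  So \<open>X - H\<close>, respectively \<open>Y - H\<close>, completes to a coordinate change, and this gives the normal forms
  supported off \<open>\<Gamma>\<close>. When the characteristic does not divide the order of one component, a
  reparameterization by a root of its unit part makes that component a pure power of \<open>t\<close> beforehand.
  In the smooth case \<open>a = 1\<close> this already leads to \<open>(t, t\<^sup>b)\<close>; for \<open>a \<ge> 2\<close> the condition that \<open>a\<close> does not
  divide \<open>b\<close> is reached by subtracting a power series in \<open>x\<close> from \<open>y\<close> (\<open>normalise\<close>).
  The forms in part (2) are those of part (1) in which one of the two sums is zero.

  The second fact is the symmetry of \<open>\<Gamma>\<close>: a number \<open>n < c\<close> lies in \<open>\<Gamma>\<close> or \<open>c - 1 - n\<close> does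
  (\<open>semigroup_symmetric\<close>). The quotient \<open>R / xR\<close> is \<open>K[y] / (y\<^sup>e)\<close>, which has a one-dimensional
  socle. It follows that modulo \<open>R\<close> the only series \<open>g\<close> with \<open>x g\<close> and \<open>y g\<close> in \<open>R\<close> are the multiples of
  \<open>t\<^sup>c\<^sup>-\<^sup>1\<close> (\<open>socle\<close>), hence that every \<open>R\<close>-submodule of \<open>K[[t]]\<close> strictly containing \<open>R\<close> contains
  \<open>t\<^sup>c\<^sup>-\<^sup>1\<close>. This is the Gorenstein property of plane branches, and symmetry is its shadow on orders.

  Symmetry allows the removal of the last gap \<open>c - 1\<close> in part (3). Take \<open>x = t\<^sup>a\<close>. Since every element of \<open>\<Gamma>\<close> below
  \<open>b\<close> is a multiple of \<open>a\<close>, the number \<open>b - a\<close> is a gap, so \<open>R\<close> has an element \<open>h\<close> of order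
  \<open>c - 1 - (b - a)\<close>. Adding \<open>\<epsilon> h\<close> to \<open>x\<close> and reparameterizing so that the first component is \<open>t\<^sup>a\<close> again
  changes \<open>y\<close> first in degree \<open>c - 1\<close>, by a nonzero multiple of \<open>\<epsilon>\<close>. With the roles of \<open>x\<close> and \<open>y\<close>
  exchanged the order needed is \<open>c - 1 + (b - a)\<close>, which is at least \<open>c\<close>.

  The successive moves may be composed because \<open>\<Gamma>\<close> is invariant under the equivalence
  (\<open>semigroup_A_equiv\<close>).
\<close>

section \<open>Power series determined coefficient by coefficient\<close>

text \<open>
  Systems that determine the coefficients of a series one after the other, such as Hensel lifting
  and triangular linear systems, all have the form \<open>\<Phi> f = f\<close> with \<open>\<Phi>\<close> causal in this sense.
\<close>

lemma fps_fixpoint_exists: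
  fixes \<Phi> :: "'a::zero fps \<Rightarrow> 'a fps"
  assumes "\<And>f g n. (\<And>k. k < n \<Longrightarrow> f $ k = g $ k) \<Longrightarrow> \<Phi> f $ n = \<Phi> g $ n"
  shows "\<exists>f. \<Phi> f = f"
proof -
  define step where "step c n = \<Phi> (Abs_fps (\<lambda>k. if k < n then c k else 0)) $ n" for c n
  define c where "c = wfrec less_than step"
  have c: "c n = step c n" for n
  proof -
    have "c n = step (cut c less_than n) n"
      unfolding c_def by (rule wfrec) simp
    also have "\<dots> = step c n"
      unfolding step_def by (rule assms) (simp add: cut_def)
    finally show ?thesis .
  qed
  have "\<Phi> (Abs_fps c) $ n = c n" for n
    unfolding c[of n] step_def by (rule assms) simp
  then have "\<Phi> (Abs_fps c) = Abs_fps c"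
    by (simp add: fps_eq_iff)
  then show ?thesis ..
qed

text \<open>
  Unlike a bound on \<^const>\<open>subdegree\<close>, which is 0 for the zero series, this holds for \<open>f = 0\<close> and every \<open>n\<close>.
\<close>

abbreviation order_ge :: "nat \<Rightarrow> 'a::zero fps \<Rightarrow> bool" where
  "order_ge n f \<equiv> \<forall>i<n. f $ i = 0"

lemma order_ge_factor:
  fixes f :: "'a::comm_ring_1 fps"
  assumes "order_ge n f"
  shows "f = fps_X ^ n * fps_shift n f"
  using assms by (simp add: fps_eq_iff fps_X_power_mult_nth)

lemma order_ge_mult:
  fixes f g :: "'a::comm_ring_1 fps"
  assumes "order_ge m f" "order_ge n g"
  shows "order_ge (m + n) (f * g)" and "(f * g) $ (m + n) = f $ m * g $ n"
proof -
  have eq: "f * g = fps_X ^ (m + n) * (fps_shift m f * fps_shift n g)"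
    by (subst order_ge_factor[OF assms(1)], subst order_ge_factor[OF assms(2)])
      (simp add: power_add mult_ac)
  show "order_ge (m + n) (f * g)" "(f * g) $ (m + n) = f $ m * g $ n"
    unfolding eq by (simp_all add: fps_X_power_mult_nth)
qed

lemma order_ge_power:
  fixes f :: "'a::comm_ring_1 fps"
  assumes "order_ge m f"
  shows "order_ge (k * m) (f ^ k)" and "(f ^ k) $ (k * m) = (f $ m) ^ k"
proof (induction k)
  case (Suc k)
  { case 1 show ?case using order_ge_mult(1)[OF assms Suc(1)] by simp }
  { case 2 show ?case using order_ge_mult(2)[OF assms Suc(1)] Suc(2) by simp }
qed simp_all

lemma order_ge_iff_subdegree: "f \<noteq> 0 \<Longrightarrow> order_ge n f \<longleftrightarrow> n \<le> subdegree f"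
  by (metis linorder_not_less nth_less_subdegree_zero nth_subdegree_nonzero order_less_le_trans)

section \<open>Substitution into a power series in two variables\<close>

lemma order_ge_monom:
  fixes x y :: "'a::comm_ring_1 fps"
  assumes "x $ 0 = 0" "y $ 0 = 0"
  shows "order_ge (i + j) (x ^ i * y ^ j)"
  using order_ge_mult(1)[OF order_ge_power(1)[of 1 x i] order_ge_power(1)[of 1 y j]] assms
  by simp

lemma subst2_nth:
  assumes "x $ 0 = 0" "y $ 0 = 0" "n \<le> M"
  shows "subst2 F (x, y) $ n = (\<Sum>j\<le>M. \<Sum>i\<le>M. F $ j $ i * (x ^ i * y ^ j) $ n)"
proof -
  have z: "(x ^ i * y ^ j) $ n = 0" if "n < i \<or> n < j" for i j
    using order_ge_monom[OF assms(1,2), of i j] that by auto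
  have "(\<Sum>j\<le>M. \<Sum>i\<le>M. F $ j $ i * (x ^ i * y ^ j) $ n)
      = (\<Sum>j\<le>n. \<Sum>i\<le>M. F $ j $ i * (x ^ i * y ^ j) $ n)"
    by (rule sum.mono_neutral_right) (use assms z in auto)
  also have "\<dots> = (\<Sum>j\<le>n. \<Sum>i\<le>n. F $ j $ i * (x ^ i * y ^ j) $ n)"
    by (intro sum.cong refl sum.mono_neutral_right) (use assms z in auto)
  finally show ?thesis by (simp add: subst2_def)
qed

lemma compose_mult_nth:
  fixes x g :: "'a::idom fps"
  assumes "x $ 0 = 0" "n \<le> M"
  shows "((f oo x) * g) $ n = (\<Sum>i\<le>M. f $ i * (x ^ i * g) $ n)"
proof -
  have fx: "(f oo x) $ k = (\<Sum>i\<le>M. f $ i * (x ^ i) $ k)" if "k \<le> n" for k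
    unfolding fps_compose_nth
    by (rule sum.mono_neutral_left)
      (use that assms startsby_zero_power_prefix[OF assms(1)] in auto)
  have "((f oo x) * g) $ n = (\<Sum>k=0..n. (\<Sum>i\<le>M. f $ i * (x ^ i) $ k) * g $ (n - k))"
    unfolding fps_mult_nth by (intro sum.cong refl) (simp add: fx)
  also have "\<dots> = (\<Sum>i\<le>M. \<Sum>k=0..n. f $ i * (x ^ i) $ k * g $ (n - k))"
    unfolding sum_distrib_right by (rule sum.swap)
  also have "\<dots> = (\<Sum>i\<le>M. f $ i * (x ^ i * g) $ n)"
    by (simp add: fps_mult_nth sum_distrib_left mult.assoc)
  finally show ?thesis .
qed

text \<open>
  Viewing \<open>K[[X, Y]]\<close> as \<open>K[[X]][[Y]]\<close> splits the substitution into a composition in each coefficient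
  and a series in powers of \<open>y\<close>. Multiplicativity then needs only one Cauchy product, the one in \<open>Y\<close>.
\<close>

lemma subst2_nth_compose:
  assumes "x $ 0 = 0" "y $ 0 = 0" "n \<le> M"
  shows "subst2 F (x, y) $ n = (\<Sum>j\<le>M. ((F $ j oo x) * y ^ j) $ n)"
  by (simp add: subst2_nth[OF assms] compose_mult_nth[OF assms(1,3)])

lemma subst2_const [simp]:
  assumes "x $ 0 = 0" "y $ 0 = 0"
  shows "subst2 (fps_const f) (x, y) = f oo x"
proof -
  have "subst2 (fps_const f) (x, y) $ n = (f oo x) $ n" for n
    unfolding subst2_nth_compose[OF assms order_refl]
    by (subst sum.atMost_shift) simp
  then show ?thesis by (simp add: fps_eq_iff)
qed

lemma subst2_Y [simp]:
  assumes "x $ 0 = 0" "y $ 0 = 0"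
  shows "subst2 fps_X (x, y) = y"
proof -
  have "subst2 fps_X (x, y) $ n = y $ n" for n
    unfolding subst2_nth_compose[OF assms le_SucI[OF order_refl]]
    by (subst sum.remove[of _ 1]) (auto intro!: sum.neutral)
  then show ?thesis by (simp add: fps_eq_iff)
qed

lemma subst2_add: "subst2 (F + G) \<psi> = subst2 F \<psi> + subst2 G \<psi>"
  by (simp add: subst2_def fps_eq_iff sum.distrib algebra_simps)

lemma subst2_uminus: "subst2 (- F) \<psi> = - subst2 F \<psi>"
  by (simp add: subst2_def fps_eq_iff sum_negf)

lemma subst2_diff: "subst2 (F - G) \<psi> = subst2 F \<psi> - subst2 G \<psi>"
  by (simp add: subst2_def fps_eq_iff sum_subtractf algebra_simps)

lemma subst2_mult:
  assumes "x $ 0 = 0" "y $ 0 = 0"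
  shows "subst2 (F * G) (x, y) = subst2 F (x, y) * subst2 G (x, y)"
proof -
  define T where "T H j = (H $ j oo x) * y ^ j" for H j
  have T: "order_ge j (T H j)" for H j
    unfolding T_def using order_ge_mult(1)[of 0 "H $ j oo x" j "y ^ j"]
      order_ge_power(1)[of 1 y j] assms by simp
  have "subst2 (F * G) (x, y) $ n = (subst2 F (x, y) * subst2 G (x, y)) $ n" for n
  proof -
    have zero: "l + m \<le> n" if "(T F l * T G m) $ n \<noteq> 0" for l m
      using order_ge_mult(1)[OF T T, of l m F G] that by (meson not_le)
    have "subst2 (F * G) (x, y) $ n = (\<Sum>j\<le>n. T (F * G) j $ n)"
      by (simp add: subst2_nth_compose[OF assms order_refl] T_def)
    also have "\<dots> = (\<Sum>j\<le>n. \<Sum>l\<le>j. (T F l * T G (j - l)) $ n)"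
    proof (rule sum.cong[OF refl])
      fix j
      have "T (F * G) j = (\<Sum>l\<le>j. T F l * T G (j - l))"
        unfolding T_def fps_mult_nth[of F G] fps_compose_sum_distrib sum_distrib_right
          fps_compose_mult_distrib[OF assms(1)] atLeast0AtMost
        by (intro sum.cong refl) (simp add: mult_ac flip: power_add)
      then show "T (F * G) j $ n = (\<Sum>l\<le>j. (T F l * T G (j - l)) $ n)"
        by (simp add: fps_sum_nth)
    qed
    also have "\<dots> = (\<Sum>(l, m)\<in>{(l, m). l + m \<le> n}. (T F l * T G m) $ n)"
      by (rule sum.triangle_reindex_eq[symmetric])
    also have "\<dots> = (\<Sum>(l, m)\<in>{..n} \<times> {..n}. (T F l * T G m) $ n)"
      by (rule sum.mono_neutral_left) (auto intro: zero)
    also have "\<dots> = ((\<Sum>l\<le>n. T F l) * (\<Sum>m\<le>n. T G m)) $ n"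
      by (simp add: sum_product fps_sum_nth sum.cartesian_product case_prod_beta)
    also have "\<dots> = (subst2 F (x, y) * subst2 G (x, y)) $ n"
      unfolding fps_mult_nth
      by (intro sum.cong refl)
        (simp add: subst2_nth_compose[OF assms, of _ n] T_def fps_sum_nth)
    finally show ?thesis .
  qed
  then show ?thesis by (simp add: fps_eq_iff)
qed

lemma subst2_1 [simp]:
  assumes "x $ 0 = 0" "y $ 0 = 0"
  shows "subst2 1 (x, y) = 1"
  using subst2_const[OF assms, of 1] by simp

lemma subst2_power:
  assumes "x $ 0 = 0" "y $ 0 = 0"
  shows "subst2 (F ^ n) (x, y) = subst2 F (x, y) ^ n"
  by (induction n) (simp_all add: assms subst2_mult)

text \<open>
  The coefficient of \<open>t\<^sup>n\<close> depends on finitely many coefficients of \<open>F\<close>, so substitution commutes with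
  infinite sums that are finite in each degree; \<open>S\<close> may vary with \<open>n\<close>.
\<close>

lemma subst2_nth_sum:
  assumes "x $ 0 = 0" "y $ 0 = 0" "n \<le> M"
    and "\<And>i j. i \<le> M \<Longrightarrow> j \<le> M \<Longrightarrow> F $ j $ i = (\<Sum>s\<in>S. c s * G s $ j $ i)"
  shows "subst2 F (x, y) $ n = (\<Sum>s\<in>S. c s * subst2 (G s) (x, y) $ n)"
proof -
  have "subst2 F (x, y) $ n
      = (\<Sum>j\<le>M. \<Sum>i\<le>M. \<Sum>s\<in>S. c s * (G s $ j $ i * (x ^ i * y ^ j) $ n))"
    unfolding subst2_nth[OF assms(1-3)]
    by (intro sum.cong refl) (simp add: assms(4) sum_distrib_right mult.assoc)
  also have "\<dots> = (\<Sum>s\<in>S. \<Sum>j\<le>M. \<Sum>i\<le>M. c s * (G s $ j $ i * (x ^ i * y ^ j) $ n))"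
    by (simp only: sum.swap[of _ S "{..M}"])
  finally show ?thesis
    by (simp add: subst2_nth[OF assms(1-3)] sum_distrib_left)
qed

lemma subst2_oo:
  assumes "x $ 0 = 0" "y $ 0 = 0" "r $ 0 = 0"
  shows "subst2 F (x oo r, y oo r) = subst2 F (x, y) oo r"
proof -
  have "subst2 F (x oo r, y oo r) $ n = (subst2 F (x, y) oo r) $ n" for n
  proof -
    have "(subst2 F (x, y) oo r) $ n
        = (\<Sum>k=0..n. (\<Sum>j\<le>n. \<Sum>i\<le>n. F $ j $ i * (x ^ i * y ^ j) $ k) * (r ^ k) $ n)"
      unfolding fps_compose_nth
      by (intro sum.cong refl) (simp add: subst2_nth[OF assms(1,2), of _ n])
    also have "\<dots> = (\<Sum>j\<le>n. \<Sum>i\<le>n. \<Sum>k=0..n. F $ j $ i * (x ^ i * y ^ j) $ k * (r ^ k) $ n)"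
      unfolding sum_distrib_right by (subst sum.swap, subst (2) sum.swap) simp
    also have "\<dots> = (\<Sum>j\<le>n. \<Sum>i\<le>n. F $ j $ i * ((x ^ i * y ^ j) oo r) $ n)"
      by (simp add: fps_compose_nth sum_distrib_left mult.assoc)
    also have "\<dots> = subst2 F (x oo r, y oo r) $ n"
      using assms by (simp add: subst2_nth[OF _ _ order_refl] fps_compose_mult_distrib fps_compose_power)
    finally show ?thesis by simp
  qed
  then show ?thesis by (simp add: fps_eq_iff)
qed

text \<open>
  Membership in the \<open>n\<close>-th power of the maximal ideal \<open>(X, Y)\<close>.
\<close>

definition mult_ge :: "nat \<Rightarrow> 'a::zero fps fps \<Rightarrow> bool" where
  "mult_ge n F \<longleftrightarrow> (\<forall>i j. i + j < n \<longrightarrow> F $ j $ i = 0)"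

lemma fps2_mult_nth: "(F * G) $ j $ i = (\<Sum>l\<le>j. \<Sum>k\<le>i. F $ l $ k * G $ (j - l) $ (i - k))"
  by (simp add: fps_mult_nth fps_sum_nth atLeast0AtMost)

lemma mult_ge_mult:
  fixes F G :: "'a::comm_ring_1 fps fps"
  assumes "mult_ge m F" "mult_ge n G"
  shows "mult_ge (m + n) (F * G)"
  unfolding mult_ge_def fps2_mult_nth
proof (intro allI impI sum.neutral ballI)
  fix i j l k assume *: "i + j < m + n" "l \<in> {..j}" "k \<in> {..i}"
  then consider "k + l < m" | "(i - k) + (j - l) < n" by fastforce
  then show "F $ l $ k * G $ (j - l) $ (i - k) = 0"
    using assms by cases (auto simp: mult_ge_def)
qed

lemma mult_ge_power:
  fixes F :: "'a::comm_ring_1 fps fps"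
  assumes "mult_ge m F"
  shows "mult_ge (k * m) (F ^ k)"
proof (induction k)
  case 0 show ?case by (simp add: mult_ge_def)
next
  case (Suc k) then show ?case using mult_ge_mult[OF assms] by simp
qed

lemma subst2_const_term:
  assumes "x $ 0 = 0" "y $ 0 = 0"
  shows "subst2 F (x, y) $ 0 = F $ 0 $ 0"
  using assms by (simp add: subst2_nth[OF _ _ order_refl])

text \<open>
  The series \<open>N\<close> is \<open>M(L1, L2)\<close>: the sum of \<open>M\<^sub>l\<^sub>k L1\<^sup>k L2\<^sup>l\<close> is finite in each degree because \<open>L1\<close> and \<open>L2\<close>
  have no constant term. The linear part of \<open>N\<close> is what the Jacobian of a composite needs.
\<close>

lemma subst2_compose:
  fixes M L1 L2 :: "'k::field fps fps"
  assumes "L1 $ 0 $ 0 = 0" "L2 $ 0 $ 0 = 0"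
  shows "\<exists>N.
    (\<forall>x y. x $ 0 = 0 \<longrightarrow> y $ 0 = 0 \<longrightarrow>
       subst2 N (x, y) = subst2 M (subst2 L1 (x, y), subst2 L2 (x, y))) \<and>
    N $ 0 $ 0 = M $ 0 $ 0 \<and>
    N $ 0 $ 1 = M $ 0 $ 1 * L1 $ 0 $ 1 + M $ 1 $ 0 * L2 $ 0 $ 1 \<and>
    N $ 1 $ 0 = M $ 0 $ 1 * L1 $ 1 $ 0 + M $ 1 $ 0 * L2 $ 1 $ 0"
proof -
  define P where "P k l = L1 ^ k * L2 ^ l" for k l :: nat
  have P: "P k l $ j $ i = 0" if "i + j < k + l" for i j k l
    using mult_ge_mult[OF mult_ge_power[of 1 L1 k] mult_ge_power[of 1 L2 l]] assms that
    by (auto simp: mult_ge_def P_def)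
  have P': "k + l \<le> i + j" if "P k l $ j $ i \<noteq> 0" for i j k l
    using P[of i j k l] that by linarith
  define N where "N = Abs_fps (\<lambda>j. Abs_fps (\<lambda>i. \<Sum>l\<le>i+j. \<Sum>k\<le>i+j. M $ l $ k * P k l $ j $ i))"
  show ?thesis
  proof (intro exI[of _ N] conjI allI impI)
    fix x y :: "'k fps" assume xy: "x $ 0 = 0" "y $ 0 = 0"
    let ?u = "subst2 L1 (x, y)" and ?v = "subst2 L2 (x, y)"
    have "subst2 N (x, y) $ n = subst2 M (?u, ?v) $ n" for n
    proof -
      have "subst2 N (x, y) $ n =
          (\<Sum>s\<in>{..2*n} \<times> {..2*n}. M $ fst s $ snd s * subst2 (P (snd s) (fst s)) (x, y) $ n)"
      proof (rule subst2_nth_sum[OF xy order_refl])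
        fix i j assume ij: "i \<le> n" "j \<le> n"
        have "N $ j $ i = (\<Sum>(l, k)\<in>{..i+j} \<times> {..i+j}. M $ l $ k * P k l $ j $ i)"
          by (simp add: N_def sum.cartesian_product)
        also have "\<dots> = (\<Sum>(l, k)\<in>{..2*n} \<times> {..2*n}. M $ l $ k * P k l $ j $ i)"
          by (rule sum.mono_neutral_left) (use ij in \<open>auto intro: add_leD1[OF P'] add_leD2[OF P']\<close>)
        finally show "N $ j $ i
          = (\<Sum>s\<in>{..2*n} \<times> {..2*n}. M $ fst s $ snd s * P (snd s) (fst s) $ j $ i)"
          by (simp add: case_prod_beta)
      qed
      also have "\<dots> = (\<Sum>l\<le>2*n. \<Sum>k\<le>2*n. M $ l $ k * (?u ^ k * ?v ^ l) $ n)"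
        by (simp add: sum.cartesian_product case_prod_beta P_def subst2_mult subst2_power xy)
      also have "\<dots> = subst2 M (?u, ?v) $ n"
        by (rule subst2_nth[symmetric]) (simp_all add: subst2_const_term xy assms)
      finally show ?thesis .
    qed
    then show "subst2 N (x, y) = subst2 M (?u, ?v)" by (simp add: fps_eq_iff)
  qed (simp_all add: N_def P_def assms numeral_2_eq_2 algebra_simps)
qed

section \<open>Equivalence of parameterizations and the ring of a branch\<close>

lemma semigroup_iff:
  "n \<in> semigroup_of \<psi> \<longleftrightarrow> (\<exists>h\<in>branch_ring \<psi>. h \<noteq> 0 \<and> subdegree h = n)"
  by (auto simp: semigroup_of_def)

lemma A_equiv_zero:
  assumes "x $ 0 = 0" "y $ 0 = 0" "(x, y) \<sim>\<^sub>A (x', y')"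
  shows "x' $ 0 = 0" "y' $ 0 = 0"
  using assms by (auto simp: A_equiv_def subst2_const_term coord_change_def)

lemma A_equiv_coords:
  assumes "coord_change L1 L2" "x' = subst2 L1 (x, y)" "y' = subst2 L2 (x, y)"
  shows "(x, y) \<sim>\<^sub>A (x', y')"
  unfolding A_equiv_def
  by (rule exI[of _ fps_X], rule exI[of _ L1], rule exI[of _ L2]) (use assms in simp)

lemma A_equiv_reparam:
  assumes "x $ 0 = 0" "y $ 0 = 0" "r $ 0 = 0" "r $ 1 \<noteq> 0"
  shows "(x, y) \<sim>\<^sub>A (x oo r, y oo r)"
  unfolding A_equiv_def
  by (rule exI[of _ r], rule exI[of _ "fps_const fps_X"], rule exI[of _ fps_X])
    (use assms in \<open>simp add: coord_change_def\<close>)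

lemma A_equiv_trans:
  assumes xy: "x $ 0 = 0" "y $ 0 = 0" and 1: "(x, y) \<sim>\<^sub>A \<phi>" and 2: "\<phi> \<sim>\<^sub>A \<chi>"
  shows "(x, y) \<sim>\<^sub>A \<chi>"
proof -
  obtain r L1 L2 where r: "r $ 0 = 0" "r $ 1 \<noteq> 0" and L: "coord_change L1 L2"
    and \<phi>: "\<phi> = (subst2 L1 (x oo r, y oo r), subst2 L2 (x oo r, y oo r))"
    using 1 by (auto simp: A_equiv_def)
  obtain s M1 M2 where s: "s $ 0 = 0" "s $ 1 \<noteq> 0" and M: "coord_change M1 M2"
    and \<chi>: "\<chi> = (subst2 M1 (fst \<phi> oo s, snd \<phi> oo s), subst2 M2 (fst \<phi> oo s, snd \<phi> oo s))"
    using 2 by (auto simp: A_equiv_def)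
  have L0: "L1 $ 0 $ 0 = 0" "L2 $ 0 $ 0 = 0"
    using L by (auto simp: coord_change_def)
  let ?\<psi> = "(x oo (r oo s), y oo (r oo s))"
  have \<phi>s: "(fst \<phi> oo s, snd \<phi> oo s) = (subst2 L1 ?\<psi>, subst2 L2 ?\<psi>)"
    using xy r s by (simp add: \<phi> fps_compose_assoc flip: subst2_oo)
  have z: "(x oo (r oo s)) $ 0 = 0" "(y oo (r oo s)) $ 0 = 0"
    using xy by simp_all
  obtain N1 where N1: "subst2 N1 ?\<psi> = subst2 M1 (subst2 L1 ?\<psi>, subst2 L2 ?\<psi>)"
    "N1 $ 0 $ 0 = M1 $ 0 $ 0"
    "N1 $ 0 $ 1 = M1 $ 0 $ 1 * L1 $ 0 $ 1 + M1 $ 1 $ 0 * L2 $ 0 $ 1"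
    "N1 $ 1 $ 0 = M1 $ 0 $ 1 * L1 $ 1 $ 0 + M1 $ 1 $ 0 * L2 $ 1 $ 0"
    using subst2_compose[OF L0, of M1] z by blast
  obtain N2 where N2: "subst2 N2 ?\<psi> = subst2 M2 (subst2 L1 ?\<psi>, subst2 L2 ?\<psi>)"
    "N2 $ 0 $ 0 = M2 $ 0 $ 0"
    "N2 $ 0 $ 1 = M2 $ 0 $ 1 * L1 $ 0 $ 1 + M2 $ 1 $ 0 * L2 $ 0 $ 1"
    "N2 $ 1 $ 0 = M2 $ 0 $ 1 * L1 $ 1 $ 0 + M2 $ 1 $ 0 * L2 $ 1 $ 0"
    using subst2_compose[OF L0, of M2] z by blast
  have "N1 $ 0 $ 1 * N2 $ 1 $ 0 - N1 $ 1 $ 0 * N2 $ 0 $ 1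
      = (M1 $ 0 $ 1 * M2 $ 1 $ 0 - M1 $ 1 $ 0 * M2 $ 0 $ 1)
        * (L1 $ 0 $ 1 * L2 $ 1 $ 0 - L1 $ 1 $ 0 * L2 $ 0 $ 1)"
    unfolding N1 N2 by algebra
  then have "coord_change N1 N2"
    using L M by (simp add: coord_change_def N1 N2)
  moreover have "(r oo s) $ 0 = 0" "(r oo s) $ 1 \<noteq> 0"
    using r s by (simp_all add: fps_compose_nth)
  ultimately show ?thesis
    unfolding A_equiv_def \<chi> \<phi>s
    by (intro exI[of _ "r oo s"] exI[of _ N1] exI[of _ N2]) (simp add: N1 N2)
qed

locale plane_pair =
  fixes x y :: "'k::field fps"
  assumes x_0 [simp]: "x $ 0 = 0" and y_0 [simp]: "y $ 0 = 0"
begin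

abbreviation "R \<equiv> branch_ring (x, y)"

lemma ring_iff: "h \<in> R \<longleftrightarrow> (\<exists>F. h = subst2 F (x, y))"
  by (auto simp: branch_ring_def)

lemma subst2_in_ring [simp, intro]: "subst2 F (x, y) \<in> R"
  by (auto simp: ring_iff)

lemma compose_in_ring [simp, intro]: "f oo x \<in> R"
  by (metis subst2_const subst2_in_ring x_0 y_0)

lemma const_in_ring [simp, intro]: "fps_const c \<in> R"
  using compose_in_ring[of "fps_const c"] by simp

lemma zero_one_in_ring [simp, intro]: "0 \<in> R" "1 \<in> R"
  using const_in_ring[of 0] const_in_ring[of 1] by simp_all

lemma x_in_ring [simp, intro]: "x \<in> R"
  using compose_in_ring[of fps_X] by simp

lemma y_in_ring [simp, intro]: "y \<in> R"
  by (metis subst2_Y subst2_in_ring x_0 y_0)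

lemma ring_add [intro]: "u \<in> R \<Longrightarrow> v \<in> R \<Longrightarrow> u + v \<in> R"
  by (metis ring_iff subst2_add)

lemma ring_diff [intro]: "u \<in> R \<Longrightarrow> v \<in> R \<Longrightarrow> u - v \<in> R"
  by (metis ring_iff subst2_diff)

lemma ring_mult [intro]: "u \<in> R \<Longrightarrow> v \<in> R \<Longrightarrow> u * v \<in> R"
  by (metis ring_iff subst2_mult x_0 y_0)

lemma ring_power [intro]: "u \<in> R \<Longrightarrow> u ^ n \<in> R"
  by (induction n) auto

lemma ring_subst2:
  assumes "u \<in> R" "v \<in> R" "u $ 0 = 0" "v $ 0 = 0"
  shows "subst2 M (u, v) \<in> R"
proof -
  obtain F G where FG: "u = subst2 F (x, y)" "v = subst2 G (x, y)"
    using assms by (auto simp: ring_iff)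
  have "F $ 0 $ 0 = 0" "G $ 0 $ 0 = 0"
    using assms by (simp_all add: FG subst2_const_term)
  with subst2_compose[of F G M] obtain N where "subst2 N (x, y) = subst2 M (u, v)"
    using x_0 y_0 unfolding FG by blast
  then show ?thesis by (metis subst2_in_ring)
qed

lemma subst2_expand_Y:
  "subst2 F (x, y) = (F $ 0 oo x) + y * subst2 (fps_shift 1 F) (x, y)"
proof -
  have "F = fps_const (F $ 0) + fps_X * fps_shift 1 F"
    by (auto simp: fps_eq_iff)
  then have "subst2 F (x, y) = subst2 (fps_const (F $ 0) + fps_X * fps_shift 1 F) (x, y)"
    by simp
  then show ?thesis by (simp add: subst2_add subst2_mult)
qed

lemma compose_expand: "f oo x = fps_const (f $ 0) + x * (fps_shift 1 f oo x)"
proof -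
  have "f = fps_const (f $ 0) + fps_X * fps_shift 1 f"
    by (auto simp: fps_eq_iff)
  then have "f oo x = (fps_const (f $ 0) + fps_X * fps_shift 1 f) oo x"
    by simp
  then show ?thesis by (simp add: fps_compose_add_distrib fps_compose_mult_distrib)
qed

lemma subst2_expand:
  obtains u v where "u \<in> R" "v \<in> R" "u $ 0 = F $ 0 $ 1" "v $ 0 = F $ 1 $ 0"
    "subst2 F (x, y) = fps_const (F $ 0 $ 0) + x * u + y * v"
proof
  show "subst2 F (x, y) = fps_const (F $ 0 $ 0) + x * (fps_shift 1 (F $ 0) oo x)
      + y * subst2 (fps_shift 1 F) (x, y)"
    by (simp only: subst2_expand_Y[of F] compose_expand[of "F $ 0"])
qed (auto simp: subst2_const_term)

end

section \<open>Invariance of the semigroup\<close>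

text \<open>
  The powers of the ideal generated by both components in the ring of the branch; the maximal ideal is
  the first power.
\<close>

primrec max_power :: "'k::field fps \<times> 'k fps \<Rightarrow> nat \<Rightarrow> 'k fps set" where
  "max_power \<psi> 0 = branch_ring \<psi>"
| "max_power \<psi> (Suc n) = {fst \<psi> * u + snd \<psi> * v | u v. u \<in> max_power \<psi> n \<and> v \<in> max_power \<psi> n}"

context plane_pair
begin

abbreviation "mpow \<equiv> max_power (x, y)"

lemma mpow_SucI [intro]: "u \<in> mpow n \<Longrightarrow> v \<in> mpow n \<Longrightarrow> x * u + y * v \<in> mpow (Suc n)"
  by auto

lemma mpow_SucE:
  assumes "h \<in> mpow (Suc n)"
  obtains u v where "u \<in> mpow n" "v \<in> mpow n" "h = x * u + y * v"
  using assms by auto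

lemma mpow_add: "u \<in> mpow n \<Longrightarrow> v \<in> mpow n \<Longrightarrow> u + v \<in> mpow n"
proof (induction n arbitrary: u v)
  case (Suc n)
  obtain u1 u2 v1 v2 where "u1 \<in> mpow n" "u2 \<in> mpow n" "v1 \<in> mpow n" "v2 \<in> mpow n"
    and uv: "u = x * u1 + y * u2" "v = x * v1 + y * v2"
    using Suc.prems by (elim mpow_SucE)
  then have "x * (u1 + v1) + y * (u2 + v2) \<in> mpow (Suc n)"
    using Suc.IH by blast
  then show ?case by (simp add: uv algebra_simps)
qed auto

lemma mpow_mult: "r \<in> R \<Longrightarrow> u \<in> mpow n \<Longrightarrow> r * u \<in> mpow n"
proof (induction n arbitrary: u)
  case (Suc n)
  obtain u1 u2 where "u1 \<in> mpow n" "u2 \<in> mpow n" and u: "u = x * u1 + y * u2"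
    using Suc.prems by (elim mpow_SucE)
  then have "x * (r * u1) + y * (r * u2) \<in> mpow (Suc n)"
    using Suc by blast
  then show ?case by (simp add: u algebra_simps)
qed auto

lemma mpow_diff: "u \<in> mpow n \<Longrightarrow> v \<in> mpow n \<Longrightarrow> u - v \<in> mpow n"
  using mpow_add[of u n "fps_const (-1) * v"] mpow_mult[OF const_in_ring[of "-1"], of v n]
  by (simp flip: fps_const_neg)

lemma mpow_Suc_subset: "u \<in> mpow (Suc n) \<Longrightarrow> u \<in> mpow n"
proof (induction n arbitrary: u)
  case 0
  then show ?case by auto
next
  case (Suc n)
  from Suc.prems obtain u1 u2 where "u1 \<in> mpow (Suc n)" "u2 \<in> mpow (Suc n)" "u = x * u1 + y * u2"
    by (rule mpow_SucE)
  then show ?case using Suc.IH by blast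
qed

declare max_power.simps(2) [simp del]

lemma mpow_order: "u \<in> mpow n \<Longrightarrow> order_ge n u"
proof (induction n arbitrary: u)
  case (Suc n)
  obtain u1 u2 where *: "u1 \<in> mpow n" "u2 \<in> mpow n" and u: "u = x * u1 + y * u2"
    using Suc.prems by (elim mpow_SucE)
  have "order_ge (1 + n) (x * u1)" "order_ge (1 + n) (y * u2)"
    using Suc.IH * by (intro order_ge_mult; simp)+
  then show ?case by (simp add: u)
qed auto

text \<open>
  Replacing \<open>x\<close> by a linear approximation is an error in the square of the maximal ideal; this bounds its
  effect on a product.
\<close>

lemma mpow_2_mult:
  assumes "q \<in> mpow 2" "u \<in> mpow n"
  shows "q * u \<in> mpow (Suc (Suc n))"
proof -
  obtain q1 q2 where q12: "q1 \<in> mpow 1" "q2 \<in> mpow 1" "q = x * q1 + y * q2"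
    using assms(1) by (auto simp: numeral_2_eq_2 elim!: mpow_SucE)
  have *: "q' * u \<in> mpow (Suc n)" if "q' \<in> mpow 1" for q'
  proof -
    have "q' \<in> mpow (Suc 0)" using that by simp
    then obtain s s' where "s \<in> R" "s' \<in> R" "q' = x * s + y * s'"
      by (rule mpow_SucE) simp
    then show ?thesis
      using mpow_SucI[OF mpow_mult[of s] mpow_mult[of s'], OF _ assms(2) _ assms(2)]
      by (simp add: algebra_simps)
  qed
  show ?thesis
    using mpow_SucI[OF *[OF q12(1)] *[OF q12(2)]] by (simp add: q12(3) algebra_simps)
qed

lemma ring_const_mpow1:
  assumes "u \<in> R"
  shows "u - fps_const (u $ 0) \<in> mpow 1"
proof -
  obtain F where F: "u = subst2 F (x, y)" using assms by (auto simp: ring_iff)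
  obtain s s' where "s \<in> R" "s' \<in> R" "u = fps_const (F $ 0 $ 0) + x * s + y * s'"
    unfolding F by (rule subst2_expand)
  moreover have "F $ 0 $ 0 = u $ 0" by (simp add: F subst2_const_term)
  ultimately have "u - fps_const (u $ 0) = x * s + y * s'"
    by (metis add.assoc add_diff_cancel_left')
  then show ?thesis
    using mpow_SucI[of s 0 s'] \<open>s \<in> R\<close> \<open>s' \<in> R\<close> by simp
qed

lemma linear_part:
  assumes "F $ 0 $ 0 = 0"
  shows "subst2 F (x, y) - (fps_const (F $ 0 $ 1) * x + fps_const (F $ 1 $ 0) * y) \<in> mpow 2"
proof -
  obtain u v where uv: "u \<in> R" "v \<in> R" "u $ 0 = F $ 0 $ 1" "v $ 0 = F $ 1 $ 0"
    "subst2 F (x, y) = fps_const (F $ 0 $ 0) + x * u + y * v"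
    by (rule subst2_expand)
  have "x * (u - fps_const (u $ 0)) + y * (v - fps_const (v $ 0)) \<in> mpow (Suc 1)"
    using uv by (blast intro: ring_const_mpow1)
  then show ?thesis
    by (simp add: uv assms algebra_simps numeral_2_eq_2)
qed

text \<open>
  The new ring \<open>R'\<close> is contained in \<open>R\<close>. Conversely \<open>x\<close> and \<open>y\<close> are linear combinations of the new
  components up to the square of the maximal ideal \<open>m\<close>, so every element of \<open>m\<^sup>n\<close> is congruent to one of
  \<open>R'\<close> modulo \<open>m\<^sup>n\<^sup>+\<^sup>1\<close>. Iterating, \<open>R = R' + m\<^sup>n\<close> for every \<open>n\<close>. As elements of \<open>m\<^sup>n\<close> have order at
  least \<open>n\<close>, both rings have the same orders. This avoids inverting the coordinate change.
\<close>

lemma semigroup_coords: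
  assumes L: "coord_change L1 L2"
  shows "semigroup_of (subst2 L1 (x, y), subst2 L2 (x, y)) = semigroup_of (x, y)"
proof -
  define x' y' where "x' = subst2 L1 (x, y)" and "y' = subst2 L2 (x, y)"
  have L0: "L1 $ 0 $ 0 = 0" "L2 $ 0 $ 0 = 0"
    using L by (auto simp: coord_change_def)
  interpret new: plane_pair x' y'
    by unfold_locales (simp_all add: x'_def y'_def subst2_const_term L0)
  have sub: "new.R \<subseteq> R"
    by (auto simp: new.ring_iff intro!: ring_subst2) (auto simp: x'_def y'_def)
  define \<alpha> \<beta> \<gamma> \<delta> where "\<alpha> = L1 $ 0 $ 1" and "\<beta> = L1 $ 1 $ 0" and "\<gamma> = L2 $ 0 $ 1" and "\<delta> = L2 $ 1 $ 0"
  define \<Delta> where "\<Delta> = \<alpha> * \<delta> - \<beta> * \<gamma>"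
  have \<Delta>: "\<Delta> \<noteq> 0"
    using L by (simp add: coord_change_def \<Delta>_def \<alpha>_def \<beta>_def \<gamma>_def \<delta>_def)
  define q1 q2 where "q1 = x' - (fps_const \<alpha> * x + fps_const \<beta> * y)"
    and "q2 = y' - (fps_const \<gamma> * x + fps_const \<delta> * y)"
  have q: "q1 \<in> mpow 2" "q2 \<in> mpow 2"
    using linear_part[OF L0(1)] linear_part[OF L0(2)]
    by (simp_all add: q1_def q2_def x'_def y'_def \<alpha>_def \<beta>_def \<gamma>_def \<delta>_def)
  \<comment> \<open>Cramer's rule for the linear parts.\<close>
  have solve: "\<exists>w\<in>new.R. z - w \<in> mpow 2" if "z \<in> {x, y}" for z
  proof -
    define C where "C c = fps_const (c / \<Delta>)" for c
    have C: "C c * fps_const d = C (c * d)" for c d by (simp add: C_def)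
    have "x - (C \<delta> * x' - C \<beta> * y') = C \<beta> * q2 - C \<delta> * q1"
    proof -
      have "C \<delta> * x' - C \<beta> * y' + (C \<beta> * q2 - C \<delta> * q1)
          = (C \<delta> * fps_const \<alpha> - C \<beta> * fps_const \<gamma>) * x + (C \<delta> * fps_const \<beta> - C \<beta> * fps_const \<delta>) * y"
        by (simp add: q1_def q2_def algebra_simps)
      also have "C \<delta> * fps_const \<alpha> - C \<beta> * fps_const \<gamma> = 1"
        using \<Delta> by (simp add: C_def \<Delta>_def mult.commute flip: fps_const_sub diff_divide_distrib)
      also have "C \<delta> * fps_const \<beta> - C \<beta> * fps_const \<delta> = 0"
        by (simp add: C_def mult.commute)
      finally show ?thesis by (simp add: algebra_simps)
    qed
    moreover have "y - (C \<alpha> * y' - C \<gamma> * x') = C \<gamma> * q1 - C \<alpha> * q2"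
    proof -
      have "C \<alpha> * y' - C \<gamma> * x' + (C \<gamma> * q1 - C \<alpha> * q2)
          = (C \<alpha> * fps_const \<delta> - C \<gamma> * fps_const \<beta>) * y + (C \<alpha> * fps_const \<gamma> - C \<gamma> * fps_const \<alpha>) * x"
        by (simp add: q1_def q2_def algebra_simps)
      also have "C \<alpha> * fps_const \<delta> - C \<gamma> * fps_const \<beta> = 1"
        using \<Delta> by (simp add: C_def \<Delta>_def mult.commute flip: fps_const_sub diff_divide_distrib)
      also have "C \<alpha> * fps_const \<gamma> - C \<gamma> * fps_const \<alpha> = 0"
        by (simp add: C_def mult.commute)
      finally show ?thesis by (simp add: algebra_simps)
    qed
    moreover have "C c * q1 - C d * q2 \<in> mpow 2" "C c * q2 - C d * q1 \<in> mpow 2" for c d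
      using q by (auto simp: C_def intro!: mpow_diff mpow_mult)
    moreover have "C c * x' - C d * y' \<in> new.R" "C c * y' - C d * x' \<in> new.R" for c d
      by (auto simp: C_def)
    ultimately show ?thesis using that by (metis insertE singletonD)
  qed
  obtain xl yl where xl: "xl \<in> new.R" "x - xl \<in> mpow 2" and yl: "yl \<in> new.R" "y - yl \<in> mpow 2"
    using solve[of x] solve[of y] by auto
  have step: "\<exists>h'\<in>new.R. h - h' \<in> mpow (Suc n)" if "h \<in> mpow n" for h n
    using that
  proof (induction n arbitrary: h)
    case 0
    then show ?case using ring_const_mpow1[of h] by (intro bexI[of _ "fps_const (h $ 0)"]) auto
  next
    case (Suc n)
    obtain u v where uv: "u \<in> mpow n" "v \<in> mpow n" "h = x * u + y * v"
      using Suc.prems by (elim mpow_SucE)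
    obtain u' v' where u': "u' \<in> new.R" "u - u' \<in> mpow (Suc n)"
      and v': "v' \<in> new.R" "v - v' \<in> mpow (Suc n)"
      using Suc.IH uv by meson
    \<comment> \<open>The approximations lie in the same power as the elements approximated, so \<open>x\<close> and \<open>y\<close> may be exchanged for \<open>xl\<close> and \<open>yl\<close>.\<close>
    have "u' \<in> mpow n" "v' \<in> mpow n"
      using mpow_diff[OF uv(1) mpow_Suc_subset[OF u'(2)]] mpow_diff[OF uv(2) mpow_Suc_subset[OF v'(2)]]
      by simp_all
    then have "(x - xl) * u' \<in> mpow (Suc (Suc n))" "(y - yl) * v' \<in> mpow (Suc (Suc n))"
      using mpow_2_mult xl yl by blast+
    moreover have "x * (u - u') + y * (v - v') \<in> mpow (Suc (Suc n))"
      using u' v' by blast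
    ultimately have "x * (u - u') + y * (v - v') + ((x - xl) * u' + (y - yl) * v') \<in> mpow (Suc (Suc n))"
      by (blast intro: mpow_add)
    then have "h - (xl * u' + yl * v') \<in> mpow (Suc (Suc n))"
      by (simp add: uv algebra_simps)
    then show ?case using xl yl u' v' by blast
  qed
  have approx: "\<exists>h'\<in>new.R. h - h' \<in> mpow n" if "h \<in> R" for h n
  proof (induction n)
    case 0
    then show ?case using that by (intro bexI[of _ 0]) auto
  next
    case (Suc n)
    then obtain h' where h': "h' \<in> new.R" "h - h' \<in> mpow n" by blast
    obtain d where "d \<in> new.R" "h - h' - d \<in> mpow (Suc n)"
      using step[OF h'(2)] by blast
    then show ?case using h' by (intro bexI[of _ "h' + d"]) (auto simp: algebra_simps)
  qed
  have "subdegree h \<in> semigroup_of (x', y')" if h: "h \<in> R" "h \<noteq> 0" for h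
  proof -
    obtain h' where h': "h' \<in> new.R" "h - h' \<in> mpow (Suc (subdegree h))"
      using approx[OF h(1)] by blast
    have eq: "h $ i = h' $ i" if "i \<le> subdegree h" for i
    proof -
      have "(h - h') $ i = 0"
        using mpow_order[OF h'(2)] that by (simp only: less_Suc_eq_le)
      then show ?thesis by simp
    qed
    have "subdegree h' = subdegree h"
    proof (rule subdegreeI)
      show "h' $ subdegree h \<noteq> 0" by (metis eq h(2) nth_subdegree_nonzero order_refl)
      show "h' $ i = 0" if "i < subdegree h" for i by (metis eq less_imp_le nth_less_subdegree_zero that)
    qed
    moreover have "h' \<noteq> 0"
      using h(2) by (metis eq fps_zero_nth nth_subdegree_nonzero order_refl)
    ultimately show ?thesis using h' by (auto simp: semigroup_iff)
  qed
  then show ?thesis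
    using sub unfolding set_eq_iff semigroup_iff x'_def[symmetric] y'_def[symmetric] by blast
qed

end

lemma semigroup_reparam:
  assumes "x $ 0 = 0" "y $ 0 = 0" "r $ 0 = 0" "r $ 1 \<noteq> 0"
  shows "semigroup_of (x oo r, y oo r) = semigroup_of (x, y)"
proof -
  have "subdegree r = 1" using assms by (intro subdegreeI) auto
  moreover have "r \<noteq> 0" using assms by auto
  moreover have img: "branch_ring (x oo r, y oo r) = (\<lambda>h. h oo r) ` branch_ring (x, y)"
    using assms by (simp add: branch_ring_def subst2_oo image_image)
  ultimately show ?thesis
    using assms by (simp add: set_eq_iff semigroup_iff img fps_compose_eq_0_iff)
qed

lemma semigroup_A_equiv:
  assumes "x $ 0 = 0" "y $ 0 = 0" "(x, y) \<sim>\<^sub>A (x', y')"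
  shows "semigroup_of (x', y') = semigroup_of (x, y)"
proof -
  obtain r L1 L2 where r: "r $ 0 = 0" "r $ 1 \<noteq> 0" and L: "coord_change L1 L2"
    and eq: "x' = subst2 L1 (x oo r, y oo r)" "y' = subst2 L2 (x oo r, y oo r)"
    using assms(3) by (auto simp: A_equiv_def)
  interpret plane_pair "x oo r" "y oo r"
    by unfold_locales (use assms in simp_all)
  show ?thesis
    using semigroup_coords[OF L] semigroup_reparam[OF assms(1,2) r] by (simp add: eq)
qed

section \<open>Gaps and conductor\<close>

text \<open>
  Enlarging a subspace by one vector creates at most one new order: from two vectors of new orders
  \<open>n < m\<close> one can cancel the added vector and keep the order \<open>n\<close>. So a subspace of finite codimension
  misses only finitely many orders.
\<close>

lemma cofinite_orders:
  fixes B :: "'k::field fps set"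
  assumes "finite B"
    and "0 \<in> V" "\<And>u v. u \<in> V \<Longrightarrow> v \<in> V \<Longrightarrow> u - v \<in> V"
    and "\<And>k v. v \<in> V \<Longrightarrow> fps_const k * v \<in> V"
    and "\<And>f. \<exists>l. f - (\<Sum>g\<in>B. fps_const (l g) * g) \<in> V"
  shows "finite {n. \<not> (\<exists>h\<in>V. h \<noteq> 0 \<and> subdegree h = n)}"
  using assms
proof (induction B arbitrary: V rule: finite_induct)
  case empty
  have "fps_X ^ n \<in> V" for n using empty.prems(4)[of "fps_X ^ n"] by simp
  then have "\<exists>h\<in>V. h \<noteq> 0 \<and> subdegree h = n" for n
    by (intro bexI[of _ "fps_X ^ n"]) (simp_all add: fps_X_power_subdegree)
  then show ?case by simp
next
  case (insert g B)
  note V0 = insert.prems(1) and Vd = insert.prems(2) and Vm = insert.prems(3)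
  define V' where "V' = {v + fps_const k * g | v k. v \<in> V}"
  define ords where "ords W = {n. \<exists>h\<in>W. h \<noteq> 0 \<and> subdegree h = n}" for W :: "'k fps set"
  have "finite {n. \<not> (\<exists>h\<in>V'. h \<noteq> 0 \<and> subdegree h = n)}"
  proof (rule insert.IH)
    show "0 \<in> V'" unfolding V'_def using V0 by (auto intro!: exI[of _ 0])
  next
    fix u v assume "u \<in> V'" "v \<in> V'"
    then obtain u0 v0 k l where *: "u0 \<in> V" "v0 \<in> V" and "u = u0 + fps_const k * g" "v = v0 + fps_const l * g"
      unfolding V'_def by auto
    then have "u - v = (u0 - v0) + fps_const (k - l) * g"
      by (simp add: algebra_simps flip: fps_const_sub)
    then show "u - v \<in> V'" unfolding V'_def using Vd[OF *] by blast
  next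
    fix k v assume "v \<in> V'"
    then obtain v0 l where *: "v0 \<in> V" and "v = v0 + fps_const l * g"
      unfolding V'_def by auto
    then have "fps_const k * v = fps_const k * v0 + fps_const (k * l) * g"
      by (simp add: algebra_simps flip: fps_const_mult)
    then show "fps_const k * v \<in> V'" unfolding V'_def using Vm[OF *] by blast
  next
    fix f
    obtain l where "f - (\<Sum>h\<in>insert g B. fps_const (l h) * h) \<in> V"
      using insert.prems(4) by blast
    moreover have "f - (\<Sum>h\<in>B. fps_const (l h) * h)
        = (f - (\<Sum>h\<in>insert g B. fps_const (l h) * h)) + fps_const (l g) * g"
      using insert.hyps by (simp add: algebra_simps)
    ultimately show "\<exists>l. f - (\<Sum>h\<in>B. fps_const (l h) * h) \<in> V'"
      unfolding V'_def by blast
  qed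
  moreover have "\<not> n < m" if n: "n \<in> ords V' - ords V" and m: "m \<in> ords V' - ords V" for n m
  proof
    assume nm: "n < m"
    obtain v k where v: "v \<in> V" "v + fps_const k * g \<noteq> 0" "subdegree (v + fps_const k * g) = n"
      using n unfolding ords_def V'_def by auto
    obtain w l where w: "w \<in> V" "w + fps_const l * g \<noteq> 0" "subdegree (w + fps_const l * g) = m"
      using m unfolding ords_def V'_def by auto
    have "l \<noteq> 0"
    proof
      assume "l = 0"
      then have "m \<in> ords V" using w by (auto simp: ords_def)
      then show False using m by simp
    qed
    define h where "h = v - fps_const (k / l) * w"
    have "h \<in> V" unfolding h_def by (intro Vd Vm v w)
    have h: "h = (v + fps_const k * g) - fps_const (k / l) * (w + fps_const l * g)"
      using \<open>l \<noteq> 0\<close> by (simp add: h_def algebra_simps flip: mult.assoc)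
    have "subdegree h = n"
    proof (rule subdegreeI)
      have "(w + fps_const l * g) $ n = 0"
        using w(3) nm nth_less_subdegree_zero by blast
      moreover have "(v + fps_const k * g) $ n \<noteq> 0"
        using v nth_subdegree_nonzero by blast
      ultimately show "h $ n \<noteq> 0"
        unfolding h by (simp only: fps_sub_nth fps_mult_left_const_nth) simp
      fix i assume "i < n"
      then have "(v + fps_const k * g) $ i = 0" "(w + fps_const l * g) $ i = 0"
        using v(3) w(3) nm by (auto intro: nth_less_subdegree_zero simp del: fps_add_nth)
      then show "h $ i = 0"
        unfolding h by (simp only: fps_sub_nth fps_mult_left_const_nth) simp
    qed
    moreover have "h \<noteq> 0"
    proof
      assume "h = 0"
      then have eq: "v + fps_const k * g = fps_const (k / l) * (w + fps_const l * g)"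
        using h by simp
      then have "k / l \<noteq> 0" using v(2) by auto
      then have "subdegree (v + fps_const k * g) = m"
        unfolding eq using w by (subst subdegree_mult) auto
      then show False using v(3) nm by simp
    qed
    ultimately have "n \<in> ords V" using \<open>h \<in> V\<close> by (auto simp: ords_def)
    then show False using n by simp
  qed
  then have "finite (ords V' - ords V)"
  proof -
    assume *: "\<And>n m. n \<in> ords V' - ords V \<Longrightarrow> m \<in> ords V' - ords V \<Longrightarrow> \<not> n < m"
    have "ords V' - ords V \<subseteq> {n}" if "n \<in> ords V' - ords V" for n
    proof
      fix m assume m: "m \<in> ords V' - ords V"
      have "m = n" using *[OF m that] *[OF that m] by linarith
      then show "m \<in> {n}" by simp
    qed
    then show ?thesis by (metis finite.emptyI finite.insertI finite_subset subsetI)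
  qed
  ultimately have "finite ({n. \<not> (\<exists>h\<in>V'. h \<noteq> 0 \<and> subdegree h = n)} \<union> (ords V' - ords V))"
    by simp
  then show ?case by (rule rev_finite_subset) (auto simp: ords_def)
qed

lemma (in plane_pair) finite_gaps_if_primitive:
  assumes "primitive (x, y)"
  shows "finite (- semigroup_of (x, y))"
proof -
  obtain B where B: "finite B" "\<And>f. \<exists>l. f - (\<Sum>g\<in>B. fps_const (l g) * g) \<in> R"
    using assms by (auto simp: primitive_def)
  have "finite {n. \<not> (\<exists>h\<in>R. h \<noteq> 0 \<and> subdegree h = n)}"
    by (rule cofinite_orders[OF B(1) _ _ _ B(2)]) auto
  then show ?thesis by (simp add: Compl_eq semigroup_iff)
qed

text \<open>
  Minimality of the conductor makes \<open>c - 1\<close> the largest gap.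
\<close>

lemma conductor_prop:
  assumes "finite (- \<Gamma>)"
  shows "n \<ge> conductor \<Gamma> \<Longrightarrow> n \<in> \<Gamma>"
    and "conductor \<Gamma> > 0 \<Longrightarrow> conductor \<Gamma> - 1 \<notin> \<Gamma>"
proof -
  let ?P = "\<lambda>n. n \<in> \<Gamma> \<and> (\<forall>m. n + m \<in> \<Gamma>)"
  obtain N where "\<forall>n\<in>- \<Gamma>. n < N"
    using assms finite_nat_set_iff_bounded by auto
  then have "?P N" by force
  then have P: "?P (conductor \<Gamma>)"
    unfolding conductor_def by (rule LeastI)
  { assume "n \<ge> conductor \<Gamma>" then show "n \<in> \<Gamma>" using P by (metis le_iff_add) }
  { assume pos: "conductor \<Gamma> > 0"
    show "conductor \<Gamma> - 1 \<notin> \<Gamma>"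
    proof
      assume *: "conductor \<Gamma> - 1 \<in> \<Gamma>"
      have "?P (conductor \<Gamma> - 1)"
      proof (intro conjI allI)
        fix m show "conductor \<Gamma> - 1 + m \<in> \<Gamma>"
          using P * pos by (cases m) (auto simp del: One_nat_def)
      qed fact
      then have "conductor \<Gamma> \<le> conductor \<Gamma> - 1"
        unfolding conductor_def by (rule Least_le)
      then show False using pos by simp
    qed }
qed

section \<open>Singular branches in normal position\<close>

text \<open>
  Since \<open>a\<close> does not divide \<open>b\<close>, this excludes the smooth case \<open>a = 1\<close>. Of primitivity only the finiteness of
  the set of gaps is recorded, because that is a property of the semigroup and thus invariant.
\<close>

locale branch = plane_pair +
  fixes a b :: nat
  assumes x_nonzero [simp]: "x \<noteq> 0" and y_nonzero [simp]: "y \<noteq> 0"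
    and ord_x: "subdegree x = a" and ord_y: "subdegree y = b"
    and a_less_b: "a < b" and a_ndvd_b: "\<not> a dvd b"
    and finite_gaps: "finite (- semigroup_of (x, y))"
begin

abbreviation "\<Gamma> \<equiv> semigroup_of (x, y)"

abbreviation "c \<equiv> conductor \<Gamma>"

lemma in_semigroup: "c \<le> n \<Longrightarrow> n \<in> \<Gamma>"
  by (rule conductor_prop[OF finite_gaps])

lemma a_ge_2: "a \<ge> 2"
proof -
  have "a \<noteq> 0" using ord_x x_0 x_nonzero subdegree_eq_0_iff by blast
  moreover have "a \<noteq> 1" using a_ndvd_b by auto
  ultimately show ?thesis by linarith
qed

lemma order_x: "order_ge a x" and x_a [simp]: "x $ a \<noteq> 0"
  using ord_x x_nonzero by (auto simp flip: ord_x intro: nth_less_subdegree_zero)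

lemma order_y: "order_ge b y" and y_b [simp]: "y $ b \<noteq> 0"
  using ord_y y_nonzero by (auto simp flip: ord_y intro: nth_less_subdegree_zero)

lemma monic_element:
  assumes "n \<in> \<Gamma>"
  obtains h where "h \<in> R" "order_ge n h" "h $ n = 1"
proof -
  obtain h where h: "h \<in> R" "h \<noteq> 0" "subdegree h = n"
    using assms by (auto simp: semigroup_iff)
  have "h $ n \<noteq> 0" using h nth_subdegree_nonzero by blast
  show thesis
  proof
    show "fps_const (1 / h $ n) * h \<in> R" using h by blast
    show "order_ge n (fps_const (1 / h $ n) * h)"
      using h by (auto intro: nth_less_subdegree_zero)
    show "(fps_const (1 / h $ n) * h) $ n = 1" using \<open>h $ n \<noteq> 0\<close> by simp
  qed
qed

lemma in_semigroup_if_order: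
  assumes "h \<in> R" "order_ge n h" "h $ n \<noteq> 0"
  shows "n \<in> \<Gamma>"
proof -
  have "subdegree h = n" using assms by (intro subdegreeI) auto
  moreover have "h \<noteq> 0" using assms by auto
  ultimately show ?thesis using assms(1) by (auto simp: semigroup_iff)
qed

lemma zero_if_off_semigroup:
  assumes "h \<in> R" "\<And>i. i \<in> \<Gamma> \<Longrightarrow> h $ i = 0"
  shows "h = 0"
  using assms by (metis nth_subdegree_nonzero semigroup_iff)

text \<open>
  This is completeness of the ring. For each \<open>n \<ge> c\<close> there is an element \<open>e n\<close> of order \<open>n\<close> of the form
  \<open>x\<^sup>q h\<close> with \<open>h\<close> of order in \<open>{c..<c + a}\<close>, and \<open>g\<close> is an infinite combination of them. As only finitely
  many \<open>h\<close> occur, the powers of \<open>X\<close> make the corresponding sum of series in \<open>X, Y\<close> finite in each degree.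
\<close>

lemma tail_in_ring:
  assumes "order_ge c g"
  shows "g \<in> R"
proof -
  have "\<exists>H. order_ge n (subst2 H (x, y)) \<and> subst2 H (x, y) $ n = 1" if "c \<le> n" for n
    using monic_element[OF in_semigroup[OF that]] by (metis ring_iff)
  then obtain H where H: "\<And>n. c \<le> n \<Longrightarrow> order_ge n (subst2 (H n) (x, y))"
      "\<And>n. c \<le> n \<Longrightarrow> subst2 (H n) (x, y) $ n = 1"
    by metis
  define q s where "q n = (n - c) div a" and "s n = c + (n - c) mod a" for n
  define G where "G n = fps_const (fps_X ^ q n) * H (s n)" for n
  define e where "e n = subst2 (G n) (x, y)" for n
  have e_eq: "e n = x ^ q n * subst2 (H (s n)) (x, y)" for n
    by (simp add: e_def G_def subst2_mult flip: fps_compose_power)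
  have n_eq: "q n * a + s n = n" if "c \<le> n" for n
    using that by (simp add: q_def s_def)
  have e: "order_ge n (e n)" "e n $ n = (x $ a) ^ q n" if "c \<le> n" for n
    using order_ge_mult[OF order_ge_power(1)[OF order_x, of "q n"] H(1)[of "s n"]]
      order_ge_power(2)[OF order_x, of "q n"] H(2)[of "s n"]
    by (simp_all add: e_eq n_eq[OF that]) (simp_all add: s_def)
  \<comment> \<open>The coefficients of the combination solve a triangular system with diagonal entries \<open>(x $ a) ^ q n\<close>.\<close>
  define \<Phi> where "\<Phi> l = Abs_fps (\<lambda>n. if n < c then 0
      else (g $ n - (\<Sum>m<n. l $ m * e m $ n)) / (x $ a) ^ q n)" for l
  have "\<exists>l. \<Phi> l = l"
    by (rule fps_fixpoint_exists) (simp add: \<Phi>_def)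
  then obtain l where l: "\<Phi> l = l" ..
  have l_less: "l $ n = 0" if "n < c" for n
    using that by (subst l[symmetric]) (simp add: \<Phi>_def)
  have l_ge: "l $ n * e n $ n = g $ n - (\<Sum>m<n. l $ m * e m $ n)" if "c \<le> n" for n
    using that by (subst l[symmetric]) (simp add: \<Phi>_def e)
  \<comment> \<open>For \<open>n \<ge> c + a * (i + 1)\<close> the series \<open>G n\<close> is divisible by \<open>X ^ (i + 1)\<close>.\<close>
  define F where "F = Abs_fps (\<lambda>j. Abs_fps (\<lambda>i. \<Sum>n<c + a * (i + 1). l $ n * G n $ j $ i))"
  have "subst2 F (x, y) $ N = g $ N" for N
  proof -
    have "subst2 F (x, y) $ N = (\<Sum>n<c + a * (N + 1). l $ n * subst2 (G n) (x, y) $ N)"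
    proof (rule subst2_nth_sum[OF x_0 y_0 order_refl])
      fix i j assume ij: "i \<le> N" "j \<le> N"
      have "F $ j $ i = (\<Sum>n<c + a * (i + 1). l $ n * G n $ j $ i)"
        by (simp add: F_def)
      also have "\<dots> = (\<Sum>n<c + a * (N + 1). l $ n * G n $ j $ i)"
      proof (rule sum.mono_neutral_left)
        show "{..<c + a * (i + 1)} \<subseteq> {..<c + a * (N + 1)}"
          using ij mult_le_mono2[of "i + 1" "N + 1" a] by auto
        show "\<forall>n\<in>{..<c + a * (N + 1)} - {..<c + a * (i + 1)}. l $ n * G n $ j $ i = 0"
        proof
          fix n assume "n \<in> {..<c + a * (N + 1)} - {..<c + a * (i + 1)}"
          then have "a * (i + 1) \<le> n - c" by auto
          then have "i + 1 \<le> q n"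
            using a_ge_2 by (simp add: q_def less_eq_div_iff_mult_less_eq mult.commute del: mult_Suc mult_Suc_right)
          then show "l $ n * G n $ j $ i = 0"
            by (simp add: G_def fps_X_power_mult_nth)
        qed
      qed simp
      finally show "F $ j $ i = (\<Sum>n<c + a * (N + 1). l $ n * G n $ j $ i)" .
    qed
    also have "\<dots> = (\<Sum>n\<le>N. l $ n * e n $ N)"
    proof (unfold e_def[symmetric], rule sum.mono_neutral_right)
      have "N < a * (N + 1)" using a_ge_2 mult_le_mono1[of 1 a "N + 1"] by simp
      then show "{..N} \<subseteq> {..<c + a * (N + 1)}" by auto
      show "\<forall>n\<in>{..<c + a * (N + 1)} - {..N}. l $ n * e n $ N = 0"
        using e(1) l_less by (metis DiffD2 atMost_iff leI mult_zero_left mult_zero_right)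
    qed simp
    also have "\<dots> = (\<Sum>n<N. l $ n * e n $ N) + l $ N * e N $ N"
      by (simp add: lessThan_Suc flip: lessThan_Suc_atMost)
    also have "\<dots> = g $ N"
    proof (cases "c \<le> N")
      case True then show ?thesis by (simp add: l_ge)
    next
      case False then show ?thesis using assms by (simp add: l_less)
    qed
    finally show ?thesis .
  qed
  then have "g = subst2 F (x, y)" by (simp add: fps_eq_iff)
  then show ?thesis by simp
qed

text \<open>
  Terms with exponent in the semigroup are removed one at a time up to the conductor; the rest is an
  element of the ring.
\<close>

lemma reduce:
  assumes "order_ge m g"
  obtains h where "h \<in> R" "order_ge m h" "\<And>i. i \<in> \<Gamma> \<Longrightarrow> (g - h) $ i = 0"
proof -
  have "\<exists>h\<in>R. order_ge m h \<and> (\<forall>i\<in>\<Gamma>. i < N \<longrightarrow> (g - h) $ i = 0)" for N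
  proof (induction N)
    case 0
    show ?case by (rule bexI[of _ 0]) auto
  next
    case (Suc N)
    then obtain h where h: "h \<in> R" "order_ge m h" "\<And>i. i \<in> \<Gamma> \<Longrightarrow> i < N \<Longrightarrow> (g - h) $ i = 0"
      by blast
    show ?case
    proof (cases "N \<in> \<Gamma> \<and> m \<le> N")
      case True
      then obtain e where e: "e \<in> R" "order_ge N e" "e $ N = 1"
        using monic_element by blast
      let ?h = "h + fps_const ((g - h) $ N) * e"
      have "?h \<in> R" using h e by blast
      moreover have "order_ge m ?h" using h e True by simp
      moreover have "(g - ?h) $ i = 0" if "i \<in> \<Gamma>" "i < Suc N" for i
        using that h(3)[of i] e by (cases "i = N") simp_all
      ultimately show ?thesis by blast
    next
      case False
      have "(g - h) $ i = 0" if "i \<in> \<Gamma>" "i < Suc N" for i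
        using that h assms False by (cases "i = N") auto
      then show ?thesis using h by blast
    qed
  qed
  from this[of c] obtain h where h: "h \<in> R" "order_ge m h" "\<And>i. i \<in> \<Gamma> \<Longrightarrow> i < c \<Longrightarrow> (g - h) $ i = 0"
    by blast
  define tail where "tail = Abs_fps (\<lambda>i. if i < c then 0 else (g - h) $ i)"
  have "tail \<in> R" by (rule tail_in_ring) (simp add: tail_def)
  show thesis
  proof
    show "h + tail \<in> R" using h \<open>tail \<in> R\<close> by blast
    show "order_ge m (h + tail)" using h assms by (simp add: tail_def)
    show "(g - (h + tail)) $ i = 0" if "i \<in> \<Gamma>" for i
      using h(3)[OF that] by (simp add: tail_def)
  qed
qed

text \<open>
  Modulo order \<open>b\<close> an element of the ring is a power series in \<open>x\<close>.
\<close>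

lemma semigroup_below_b:
  assumes "n \<in> \<Gamma>" "n < b"
  shows "a dvd n"
proof -
  obtain F where F: "subst2 F (x, y) \<noteq> 0" "subdegree (subst2 F (x, y)) = n"
    using assms by (auto simp: semigroup_iff ring_iff)
  let ?f = "F $ 0 oo x"
  have eq: "subst2 F (x, y) $ i = ?f $ i" if "i < b" for i
    using order_ge_mult(1)[OF order_y, of 0 "subst2 (fps_shift 1 F) (x, y)"] that
    by (subst subst2_expand_Y) simp
  have "subdegree ?f = n"
  proof (rule subdegreeI)
    show "?f $ n \<noteq> 0" using eq[OF assms(2)] F nth_subdegree_nonzero by metis
    show "?f $ i = 0" if "i < n" for i
      using eq[of i] that assms(2) F(2) nth_less_subdegree_zero by (metis order.strict_trans)
  qed
  then show ?thesis by (auto simp: ord_x)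
qed

lemma diff_notin_semigroup: "b - a \<notin> \<Gamma>"
proof
  assume "b - a \<in> \<Gamma>"
  then have "a dvd b - a" using semigroup_below_b a_less_b a_ge_2 by simp
  then have "a dvd b - a + a" by simp
  then show False using a_less_b a_ndvd_b by simp
qed

text \<open>
  Among the monomials in \<open>x\<close> and \<open>y\<close> only \<open>1\<close> and \<open>x\<close> have order at most \<open>a\<close>.
\<close>

lemma no_X_term:
  assumes "order_ge (Suc a) (subst2 F (x, y))"
  shows "F $ 0 $ 0 = 0" "F $ 0 $ 1 = 0"
proof -
  show F0: "F $ 0 $ 0 = 0" using assms subst2_const_term[OF x_0 y_0, of F] by simp
  obtain u v where uv: "u $ 0 = F $ 0 $ 1"
    "subst2 F (x, y) = fps_const (F $ 0 $ 0) + x * u + y * v"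
    by (rule subst2_expand)
  have "subst2 F (x, y) $ a = x $ a * F $ 0 $ 1"
    using order_ge_mult(2)[OF order_x, of 0 u] order_ge_mult(1)[OF order_y, of 0 v] a_less_b
    by (simp add: uv F0)
  then show "F $ 0 $ 1 = 0" using assms by simp
qed

text \<open>
  A term \<open>Y\<close> contributes to \<open>F(x, y)\<close> in degree \<open>b\<close>. Only a power series in \<open>x\<close> could cancel it there,
  and the order of such a series is a multiple of \<open>a\<close>, hence different from \<open>b\<close>.
\<close>

lemma no_Y_term:
  assumes "order_ge (Suc b) (subst2 F (x, y))"
  shows "F $ 0 $ 0 = 0" "F $ 1 $ 0 = 0"
proof -
  show "F $ 0 $ 0 = 0" using assms subst2_const_term[OF x_0 y_0, of F] by simp
  let ?f = "F $ 0 oo x" and ?v = "subst2 (fps_shift 1 F) (x, y)"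
  have yv: "order_ge b (y * ?v)" "(y * ?v) $ b = y $ b * F $ 1 $ 0"
    using order_ge_mult[OF order_y, of 0 ?v] by (simp_all add: subst2_const_term)
  have "order_ge b ?f"
    using assms yv by (subst (asm) subst2_expand_Y) (simp add: less_Suc_eq)
  have "?f $ b = 0"
  proof (rule ccontr)
    assume "?f $ b \<noteq> 0"
    then have "subdegree ?f = b" using \<open>order_ge b ?f\<close> by (intro subdegreeI) auto
    then have "subdegree (F $ 0) * a = b" by (simp add: ord_x)
    then show False using a_ndvd_b by auto
  qed
  moreover have "subst2 F (x, y) $ b = 0" using assms by simp
  ultimately have "y $ b * F $ 1 $ 0 = 0"
    using yv(2) by (subst (asm) subst2_expand_Y) simp
  then show "F $ 1 $ 0 = 0" by simp
qed

end

context branch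
begin

section \<open>Symmetry of the semigroup\<close>

definition "xR = (*) x ` R"

lemma xR_I: "r \<in> R \<Longrightarrow> x * r \<in> xR"
  by (auto simp: xR_def)

lemma xR_add: "f \<in> xR \<Longrightarrow> g \<in> xR \<Longrightarrow> f + g \<in> xR"
  by (auto simp: xR_def simp flip: distrib_left intro!: imageI)

lemma xR_diff: "f \<in> xR \<Longrightarrow> g \<in> xR \<Longrightarrow> f - g \<in> xR"
  by (auto simp: xR_def simp flip: right_diff_distrib intro!: imageI)

lemma xR_mult: "r \<in> R \<Longrightarrow> f \<in> xR \<Longrightarrow> r * f \<in> xR"
  by (auto simp: xR_def mult.left_commute intro!: imageI)

lemma xR_sum: "(\<And>i. i \<in> A \<Longrightarrow> f i \<in> xR) \<Longrightarrow> (\<Sum>i\<in>A. f i) \<in> xR"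
proof (induction A rule: infinite_finite_induct)
  case (insert i A)
  then show ?case by (simp add: xR_add)
qed (use xR_I[of 0] in auto)

lemma divide_by_x:
  assumes "order_ge (a + n) f"
  shows "\<exists>g. f = x * g \<and> order_ge n g"
proof -
  define u where "u = fps_shift a x"
  define g where "g = fps_X ^ n * (fps_shift (a + n) f * inverse u)"
  have "u $ 0 \<noteq> 0" by (simp add: u_def)
  have "x * g = fps_X ^ (a + n) * fps_shift (a + n) f * (u * inverse u)"
    by (subst order_ge_factor[OF order_x]) (simp add: g_def power_add mult_ac flip: u_def)
  also have "\<dots> = f"
    using order_ge_factor[OF assms] \<open>u $ 0 \<noteq> 0\<close> by (simp add: inverse_mult_eq_1')
  finally have "f = x * g" ..
  moreover have "order_ge n g" by (simp add: g_def fps_X_power_mult_nth)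
  ultimately show ?thesis by blast
qed

lemma xR_if_order:
  assumes "order_ge (a + c) f"
  shows "f \<in> xR"
  using divide_by_x[OF assms] tail_in_ring xR_I by blast

text \<open>The ring modulo \<open>x\<close> is \<open>K[y] / (y\<^sup>e)\<close>, spanned by the powers of \<open>y\<close> below \<open>e\<close>.\<close>

definition "e = (LEAST n. y ^ n \<in> xR)"

lemma y_power_e: "y ^ e \<in> xR"
proof -
  have le: "a + c \<le> (a + c) * b" using a_less_b by simp
  have "y ^ (a + c) \<in> xR"
  proof (rule xR_if_order, intro allI impI)
    fix i assume "i < a + c"
    then show "(y ^ (a + c)) $ i = 0"
      using order_ge_power(1)[OF order_y, of "a + c"] le by (meson less_le_trans)
  qed
  then show ?thesis unfolding e_def by (rule LeastI)
qed

lemma y_power_less_e: "n < e \<Longrightarrow> y ^ n \<notin> xR"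
  unfolding e_def by (rule not_less_Least)

lemma e_pos: "0 < e"
proof (rule ccontr)
  assume "\<not> 0 < e"
  then have "1 \<in> xR" using y_power_e by simp
  then obtain r where "1 = x * r" by (auto simp: xR_def)
  then have "(1 :: 'a fps) $ 0 = (x * r) $ 0" by simp
  then show False by simp
qed

text \<open>
  Taylor expansion in \<open>y\<close> modulo \<open>xR\<close>.
\<close>

lemma ring_expansion:
  assumes "u \<in> R"
  shows "\<exists>\<kappa> v w. v \<in> R \<and> w \<in> R \<and>
    u = (\<Sum>i<k. fps_const (\<kappa> i) * y ^ i) + x * v + y ^ k * w"
proof (induction k)
  case 0
  then show ?case using assms by (intro exI[of _ "\<lambda>_. 0"] exI[of _ 0] exI[of _ u]) simp
next
  case (Suc k)
  then obtain \<kappa> v w where vw: "v \<in> R" "w \<in> R"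
    and u: "u = (\<Sum>i<k. fps_const (\<kappa> i) * y ^ i) + x * v + y ^ k * w"
    by blast
  obtain F where "w = subst2 F (x, y)" using vw by (auto simp: ring_iff)
  then obtain s t d where st: "s \<in> R" "t \<in> R" and w: "w = fps_const d + x * s + y * t"
    using subst2_expand[of F] by metis
  have "(\<Sum>i<Suc k. fps_const ((\<kappa>(k := d)) i) * y ^ i)
      = (\<Sum>i<k. fps_const (\<kappa> i) * y ^ i) + fps_const d * y ^ k"
    by simp
  then have "u = (\<Sum>i<Suc k. fps_const ((\<kappa>(k := d)) i) * y ^ i) + x * (v + y ^ k * s) + y ^ Suc k * t"
    unfolding u w by (simp add: algebra_simps)
  moreover have "v + y ^ k * s \<in> R" using vw st by auto
  ultimately show ?case using st by blast
qed

text \<open>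
  The annihilator of \<open>y\<close> in \<open>K[y] / (y\<^sup>e)\<close> is spanned by \<open>y\<^sup>e\<^sup>-\<^sup>1\<close>.
\<close>

lemma colon_xR:
  assumes "u \<in> R" "y * u \<in> xR"
  shows "\<exists>\<kappa> v. v \<in> R \<and> u = fps_const \<kappa> * y ^ (e - 1) + x * v"
proof -
  obtain \<kappa> v w where vw: "v \<in> R" "w \<in> R"
    and u0: "u = (\<Sum>i<e. fps_const (\<kappa> i) * y ^ i) + x * v + y ^ e * w"
    using ring_expansion[OF assms(1)] by blast
  obtain w' where w': "w' \<in> R" "w * y ^ e = x * w'"
    using xR_mult[OF vw(2) y_power_e] by (auto simp: xR_def)
  define z where "z = v + w'"
  have z: "z \<in> R" using vw w' by (auto simp: z_def)
  have u: "u = (\<Sum>i<e. fps_const (\<kappa> i) * y ^ i) + x * z"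
    by (simp add: u0 z_def distrib_left mult.commute[of "y ^ e"] w' add.assoc)
  have \<kappa>: "\<kappa> i = 0" if "i < e - 1" for i
    using that
  proof (induction i rule: less_induct)
    case (less i)
    define d where "d = e - 1 - i"
    have d: "0 < d" "d + i = e - 1" using less.prems by (auto simp: d_def)
    let ?B = "\<Sum>j\<in>{i<..<e}. fps_const (\<kappa> j) * y ^ (d + j)" and ?C = "x * (y ^ d * z)"
    \<comment> \<open>Multiplying by \<open>y ^ d\<close> moves the lowest remaining term to \<open>y ^ (e - 1)\<close> and all later ones into \<open>xR\<close>.\<close>
    have "y ^ d * u = y ^ (d - 1) * (y * u)"
      using d by (simp flip: power_Suc2 mult.assoc)
    then have "y ^ d * u \<in> xR"
      by (metis assms(2) ring_power xR_mult y_in_ring)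
    moreover have "y ^ d * u = fps_const (\<kappa> i) * y ^ (e - 1)
        + ((\<Sum>j\<in>{i<..<e}. fps_const (\<kappa> j) * y ^ (d + j)) + x * (y ^ d * z))"
    proof -
      have "y ^ d * u = (\<Sum>j<e. fps_const (\<kappa> j) * y ^ (d + j)) + x * (y ^ d * z)"
        by (simp add: u algebra_simps sum_distrib_left power_add)
      also have "(\<Sum>j<e. fps_const (\<kappa> j) * y ^ (d + j)) = (\<Sum>j\<in>{i..<e}. fps_const (\<kappa> j) * y ^ (d + j))"
        by (rule sum.mono_neutral_right) (use less in auto)
      also have "{i..<e} = insert i {i<..<e}" using less.prems by auto
      also have "(\<Sum>j\<in>insert i {i<..<e}. fps_const (\<kappa> j) * y ^ (d + j))
          = fps_const (\<kappa> i) * y ^ (e - 1) + (\<Sum>j\<in>{i<..<e}. fps_const (\<kappa> j) * y ^ (d + j))"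
        by (simp add: d)
      finally show ?thesis by (simp add: add.assoc)
    qed
    moreover have "(\<Sum>j\<in>{i<..<e}. fps_const (\<kappa> j) * y ^ (d + j)) \<in> xR"
    proof (rule xR_sum)
      fix j assume "j \<in> {i<..<e}"
      then have "d + j = (d + j - e) + e" using d by auto
      then have "y ^ (d + j) = y ^ (d + j - e) * y ^ e" by (metis power_add)
      then show "fps_const (\<kappa> j) * y ^ (d + j) \<in> xR"
        using xR_mult[OF const_in_ring xR_mult[OF ring_power[OF y_in_ring] y_power_e]] by simp
    qed
    moreover have "x * (y ^ d * z) \<in> xR" using z by (intro xR_I) auto
    ultimately have *: "fps_const (\<kappa> i) * y ^ (e - 1) \<in> xR"
      using xR_diff[of "y ^ d * u" "?B + ?C"] xR_add[of ?B ?C] by simp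
    show ?case
    proof (rule ccontr)
      assume "\<kappa> i \<noteq> 0"
      then have "y ^ (e - 1) = fps_const (1 / \<kappa> i) * (fps_const (\<kappa> i) * y ^ (e - 1))"
        by (simp flip: mult.assoc)
      then have "y ^ (e - 1) \<in> xR" using xR_mult[OF const_in_ring *] by metis
      then show False using y_power_less_e[of "e - 1"] e_pos by simp
    qed
  qed
  have "(\<Sum>i<e. fps_const (\<kappa> i) * y ^ i) = (\<Sum>i\<in>{e - 1}. fps_const (\<kappa> i) * y ^ i)"
  proof (rule sum.mono_neutral_right)
    show "\<forall>i\<in>{..<e} - {e - 1}. fps_const (\<kappa> i) * y ^ i = 0"
    proof
      fix i assume "i \<in> {..<e} - {e - 1}"
      then have "i < e - 1" by auto
      then show "fps_const (\<kappa> i) * y ^ i = 0" by (simp add: \<kappa>)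
    qed
  qed (use e_pos in auto)
  then show ?thesis using u z by auto
qed

lemma c_ge_2: "c \<ge> 2"
proof (rule ccontr)
  assume "\<not> c \<ge> 2"
  then have "a dvd 1" using a_ge_2 a_less_b by (intro semigroup_below_b in_semigroup) auto
  then show False using a_ge_2 by simp
qed

lemma c_minus_1: "c - 1 \<notin> \<Gamma>"
  using conductor_prop(2)[OF finite_gaps] c_ge_2 by simp

text \<open>
  The power of \<open>t\<close> whose exponent is the largest gap. It spans the socle of \<open>K[[t]] / R\<close>.
\<close>

abbreviation "T \<equiv> fps_X ^ (c - 1) :: 'a fps"

lemma T_notin_ring: "T \<notin> R"
  using in_semigroup_if_order[of T "c - 1"] c_minus_1 by auto

text \<open>
  Multiplication by \<open>x\<close> sends such a \<open>g\<close> into the one-dimensional space of \<open>colon_xR\<close>, modulo \<open>xR\<close>. The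
  monomial \<open>T\<close> is one such series and does not lie in the ring, so every other is a multiple of it.
\<close>

lemma socle:
  assumes "x * g \<in> R" "y * g \<in> R"
  shows "\<exists>\<kappa>. g - fps_const \<kappa> * T \<in> R"
proof -
  have order: "order_ge c (x * T)" "order_ge c (y * T)"
    using order_ge_mult(1)[of 1 x "c - 1" T] order_ge_mult(1)[of 1 y "c - 1" T] c_ge_2
    by simp_all
  have *: "\<exists>\<kappa> v. v \<in> R \<and> x * g = fps_const \<kappa> * y ^ (e - 1) + x * v"
    if "x * g \<in> R" "y * g \<in> R" for g
    using colon_xR[OF that(1)] xR_I[OF that(2)] by (simp add: mult.left_commute)
  obtain \<kappa>0 v0 where v0: "v0 \<in> R" "x * T = fps_const \<kappa>0 * y ^ (e - 1) + x * v0"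
    using *[OF order[THEN tail_in_ring]] by blast
  have "\<kappa>0 \<noteq> 0"
  proof
    assume "\<kappa>0 = 0"
    then have "T = v0" using v0(2) by simp
    then show False using T_notin_ring v0 by simp
  qed
  obtain \<kappa> v where v: "v \<in> R" "x * g = fps_const \<kappa> * y ^ (e - 1) + x * v"
    using *[OF assms] by blast
  have "fps_const \<kappa> * y ^ (e - 1) = fps_const (\<kappa> / \<kappa>0) * (fps_const \<kappa>0 * y ^ (e - 1))"
    using \<open>\<kappa>0 \<noteq> 0\<close> by (simp flip: mult.assoc)
  also have "fps_const \<kappa>0 * y ^ (e - 1) = x * (T - v0)"
    using v0(2) by (simp add: right_diff_distrib)
  finally have "x * g = x * (fps_const (\<kappa> / \<kappa>0) * (T - v0) + v)"
    using v(2) by (simp add: algebra_simps)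
  then have "g = fps_const (\<kappa> / \<kappa>0) * (T - v0) + v"
    by simp
  then have "g - fps_const (\<kappa> / \<kappa>0) * T = v - fps_const (\<kappa> / \<kappa>0) * v0"
    by (simp add: algebra_simps)
  moreover have "v - fps_const (\<kappa> / \<kappa>0) * v0 \<in> R" using v v0 by blast
  ultimately show ?thesis by metis
qed

text \<open>
  Multiply \<open>g\<close> by \<open>x\<close> or \<open>y\<close> as long as the result stays outside the ring. The order grows and cannot
  reach \<open>c\<close>, so the process stops at an element of the socle.
\<close>

lemma module_contains_T:
  assumes "g \<notin> R"
  shows "\<exists>h\<in>R. \<exists>\<kappa>. \<kappa> \<noteq> 0 \<and> h * g - fps_const \<kappa> * T \<in> R"
proof -
  have "\<exists>h\<in>R. \<exists>\<kappa>. \<kappa> \<noteq> 0 \<and> h * g - fps_const \<kappa> * T \<in> R"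
    if "g \<notin> R" "order_ge (c - n) g" for n g
    using that
  proof (induction n arbitrary: g)
    case 0
    then show ?case using tail_in_ring by simp
  next
    case (Suc n)
    show ?case
    proof (cases "x * g \<in> R \<and> y * g \<in> R")
      case True
      then obtain \<kappa> where \<kappa>: "g - fps_const \<kappa> * T \<in> R" using socle by blast
      then have "\<kappa> \<noteq> 0" using Suc.prems by auto
      then show ?thesis using \<kappa> by (intro bexI[of _ 1] exI[of _ \<kappa>]) auto
    next
      case False
      then obtain z where z: "z \<in> R" "z $ 0 = 0" "z * g \<notin> R" by (metis x_in_ring y_in_ring x_0 y_0)
      have "order_ge (c - n) (z * g)"
        using order_ge_mult(1)[of 1 z "c - Suc n" g] Suc.prems z by auto
      then obtain h \<kappa> where "h \<in> R" "\<kappa> \<noteq> 0" "h * (z * g) - fps_const \<kappa> * T \<in> R"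
        using Suc.IH z by blast
      then show ?thesis using z(1) by (intro bexI[of _ "h * z"] exI[of _ \<kappa>]) (auto simp: mult.assoc)
    qed
  qed
  from this[of g c] assms show ?thesis by simp
qed

text \<open>
  The representative of \<open>g\<close> modulo the ring that is supported on the gaps; it is unique.
\<close>

definition reduced :: "'a fps \<Rightarrow> 'a fps" where
  "reduced g = (SOME d. (\<forall>i\<in>\<Gamma>. d $ i = 0) \<and> g - d \<in> R)"

lemma reduced_unique:
  assumes "\<And>i. i \<in> \<Gamma> \<Longrightarrow> d $ i = 0" "g - d \<in> R"
  shows "reduced g = d"
proof -
  have "(\<forall>i\<in>\<Gamma>. reduced g $ i = 0) \<and> g - reduced g \<in> R"
    unfolding reduced_def by (rule someI[of _ d]) (use assms in blast)
  then have "reduced g - d = 0"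
    using assms ring_diff[of "g - d" "g - reduced g"] by (intro zero_if_off_semigroup) auto
  then show ?thesis by simp
qed

lemma reduced: "i \<in> \<Gamma> \<Longrightarrow> reduced g $ i = 0" "g - reduced g \<in> R"
proof -
  obtain h where h: "h \<in> R" "\<And>i. i \<in> \<Gamma> \<Longrightarrow> (g - h) $ i = 0"
    using reduce[of 0 g] by auto
  have "reduced g = g - h" by (rule reduced_unique) (use h in auto)
  then show "i \<in> \<Gamma> \<Longrightarrow> reduced g $ i = 0" "g - reduced g \<in> R" using h by simp_all
qed

text \<open>
  A linear functional that vanishes on the ring and takes the value 1 at \<open>T\<close>. The form
  \<open>(f, g) \<mapsto> top_coeff (f * g)\<close> is the residue pairing under which the ring is its own orthogonal complement.
\<close>

definition top_coeff :: "'a fps \<Rightarrow> 'a" where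
  "top_coeff g = reduced g $ (c - 1)"

lemma top_coeff_add: "top_coeff (f + g) = top_coeff f + top_coeff g"
proof -
  have "(f + g) - (reduced f + reduced g) = (f - reduced f) + (g - reduced g)" by simp
  also have "\<dots> \<in> R" using reduced by blast
  finally have "reduced (f + g) = reduced f + reduced g"
    by (intro reduced_unique) (simp_all add: reduced)
  then show ?thesis by (simp add: top_coeff_def)
qed

lemma top_coeff_scale: "top_coeff (fps_const k * g) = k * top_coeff g"
proof -
  have "fps_const k * g - fps_const k * reduced g = fps_const k * (g - reduced g)"
    by (simp add: algebra_simps)
  also have "\<dots> \<in> R" using reduced by blast
  finally have "reduced (fps_const k * g) = fps_const k * reduced g"
    by (intro reduced_unique) (simp_all add: reduced)
  then show ?thesis by (simp add: top_coeff_def)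
qed

lemma top_coeff_ring: "h \<in> R \<Longrightarrow> top_coeff h = 0"
  using reduced_unique[of 0 h] by (simp add: top_coeff_def)

lemma top_coeff_order:
  assumes "order_ge (c - 1) g"
  shows "top_coeff g = g $ (c - 1)"
proof -
  have "g - fps_const (g $ (c - 1)) * T \<in> R"
  proof (rule tail_in_ring, intro allI impI)
    fix i assume "i < c"
    then show "(g - fps_const (g $ (c - 1)) * T) $ i = 0"
      using assms by (cases "i = c - 1") auto
  qed
  moreover have "(fps_const (g $ (c - 1)) * T) $ i = 0" if "i \<in> \<Gamma>" for i
    using that c_minus_1 by auto
  ultimately have "reduced g = fps_const (g $ (c - 1)) * T"
    by (intro reduced_unique)
  then show ?thesis by (simp add: top_coeff_def)
qed

text \<open>
  Suppose that \<open>N\<close> and \<open>c - 1 - N\<close> are both gaps. Then some series of order \<open>N\<close> is orthogonal to the whole ring.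
  Indeed, orthogonality to the element \<open>h j\<close> of order \<open>j\<close> is a condition whose last unknown is the
  coefficient at \<open>c - 1 - j\<close>, so these conditions can be solved one after the other; the condition for
  \<open>j = c - 1 - N\<close>, which would fix the leading coefficient, does not occur. By \<open>module_contains_T\<close> a
  series outside the ring cannot be orthogonal to it.
\<close>

theorem semigroup_symmetric:
  assumes "N < c" "N \<notin> \<Gamma>"
  shows "c - 1 - N \<in> \<Gamma>"
proof (rule ccontr)
  assume N': "c - 1 - N \<notin> \<Gamma>"
  have "\<exists>h. h \<in> R \<and> order_ge j h \<and> h $ j = 1" if "j \<in> \<Gamma>" for j
    using monic_element[OF that] by blast
  then obtain h where h: "\<And>j. j \<in> \<Gamma> \<Longrightarrow> h j \<in> R" "\<And>j. j \<in> \<Gamma> \<Longrightarrow> order_ge j (h j)"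
      "\<And>j. j \<in> \<Gamma> \<Longrightarrow> h j $ j = 1"
    by metis
  define \<Phi> where "\<Phi> g = Abs_fps (\<lambda>k. if k = N then 1
      else if N < k \<and> k < c \<and> c - 1 - k \<in> \<Gamma> then g $ k - top_coeff (h (c - 1 - k) * g) else 0)"
    for g :: "'a fps"
  have "\<exists>g. \<Phi> g = g"
  proof (rule fps_fixpoint_exists)
    fix f g :: "'a fps" and k assume fg: "\<And>i. i < k \<Longrightarrow> f $ i = g $ i"
    show "\<Phi> f $ k = \<Phi> g $ k"
    proof (cases "N < k \<and> k < c \<and> c - 1 - k \<in> \<Gamma>")
      case True
      let ?h = "h (c - 1 - k)"
      have "?h * f = ?h * g + ?h * (f - g)" by (simp add: algebra_simps)
      then have "top_coeff (?h * f) = top_coeff (?h * g) + top_coeff (?h * (f - g))"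
        by (simp add: top_coeff_add)
      moreover have "top_coeff (?h * (f - g)) = f $ k - g $ k"
        using order_ge_mult[OF h(2), of "c - 1 - k" k "f - g"] True fg
        by (subst top_coeff_order) (simp_all add: h)
      ultimately show ?thesis using True by (simp add: \<Phi>_def)
    next
      case False
      then show ?thesis unfolding \<Phi>_def by auto
    qed
  qed
  then obtain g where g: "\<Phi> g = g" ..
  have g_less: "order_ge N g" and g_N: "g $ N = 1"
    by (subst g[symmetric], simp add: \<Phi>_def)+
  have hg: "top_coeff (h j * g) = 0" if j: "j \<in> \<Gamma>" "j < c" for j
  proof (cases "j + N < c - 1")
    case True
    define k where "k = c - 1 - j"
    have k: "N < k" "k < c" "c - 1 - k = j" "k \<noteq> N" using True by (auto simp: k_def)
    have "g $ k = \<Phi> g $ k" by (simp only: g)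
    then show ?thesis using k j by (simp add: \<Phi>_def)
  next
    case False
    moreover have "j + N \<noteq> c - 1"
    proof
      assume "j + N = c - 1"
      then have "j = c - 1 - N" by simp
      then show False using j N' by simp
    qed
    ultimately have "c \<le> j + N" using c_ge_2 by linarith
    then have "order_ge c (h j * g)"
      using order_ge_mult(1)[OF h(2)[OF j(1)] g_less] by auto
    then show ?thesis by (intro top_coeff_ring tail_in_ring)
  qed
  have "top_coeff (r * g) = 0" if "r \<in> R" "order_ge (c - n) r" for r n
    using that
  proof (induction n arbitrary: r)
    case 0
    then have "order_ge (c + 0) (r * g)" by (intro order_ge_mult) auto
    then show ?case by (intro top_coeff_ring tail_in_ring) simp
  next
    case (Suc n)
    show ?case
    proof (cases "n < c \<and> r $ (c - Suc n) \<noteq> 0")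
      case True
      let ?j = "c - Suc n"
      let ?r = "r - fps_const (r $ ?j) * h ?j"
      have j: "?j \<in> \<Gamma>" using in_semigroup_if_order Suc.prems True by blast
      have "?r $ i = 0" if "i < c - n" for i
        using that Suc.prems h(2,3)[OF j] True by (cases "i = ?j") auto
      moreover have "?r \<in> R" using Suc.prems h(1)[OF j] by blast
      ultimately have "top_coeff (?r * g) = 0" using Suc.IH by blast
      moreover have "r * g = ?r * g + fps_const (r $ ?j) * (h ?j * g)"
        by (simp add: algebra_simps)
      moreover have "top_coeff (h ?j * g) = 0" using hg[OF j] True by simp
      ultimately have "top_coeff (r * g) = 0 + r $ ?j * 0"
        by (metis top_coeff_add top_coeff_scale)
      then show ?thesis by simp
    next
      case False
      have "r $ i = 0" if "i < c - n" for i
        using that Suc.prems False by (cases "i = c - Suc n") auto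
      then show ?thesis using Suc by blast
    qed
  qed
  from this[of _ c] have zero: "top_coeff (r * g) = 0" if "r \<in> R" for r
    using that by simp
  have "g \<notin> R" using in_semigroup_if_order[OF _ g_less] g_N assms(2) by auto
  then obtain r \<kappa> where r: "r \<in> R" "\<kappa> \<noteq> 0" "r * g - fps_const \<kappa> * T \<in> R"
    using module_contains_T by blast
  have "r * g = (r * g - fps_const \<kappa> * T) + fps_const \<kappa> * T" by simp
  then have "top_coeff (r * g) = top_coeff (r * g - fps_const \<kappa> * T) + \<kappa> * top_coeff T"
    by (metis top_coeff_add top_coeff_scale)
  also have "\<dots> = \<kappa>"
    using top_coeff_ring[OF r(3)] top_coeff_order[of T] by simp
  finally have "top_coeff (r * g) = \<kappa>" .
  then show False using zero[OF r(1)] r(2) by simp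
qed

end

section \<open>Roots of power series and reparameterizations\<close>

lemma power_diff_nth:
  fixes f g :: "'a::comm_ring_1 fps"
  assumes "f $ 0 = 1" "g $ 0 = 1" "order_ge n (f - g)"
  shows "(f ^ m) $ n - (g ^ m) $ n = of_nat m * (f $ n - g $ n)"
proof -
  define S where "S = (\<Sum>i<m. g ^ (m - Suc i) * f ^ i)"
  have "S $ 0 = of_nat m"
    using assms by (simp add: S_def fps_sum_nth fps_nth_power_0)
  moreover have "f ^ m - g ^ m = (f - g) * S"
    unfolding S_def by (rule power_diff_sumr2)
  then have "(f ^ m - g ^ m) $ n = ((f - g) * S) $ n" by simp
  moreover have "((f - g) * S) $ (n + 0) = (f - g) $ n * S $ 0"
    by (rule order_ge_mult(2)) (use assms in auto)
  ultimately show ?thesis by (simp add: mult.commute)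
qed

text \<open>
  Newton iteration with the derivative frozen at its value \<open>m\<close> in the constant term: each step fixes one
  more coefficient. The value of \<open>\<Phi>\<close> at series with another constant term is set to 1 only to make the
  constant term of \<open>\<Phi> v\<close> independent of \<open>v\<close>.
\<close>

lemma fps_unit_root:
  fixes u :: "'a::field fps"
  assumes "u $ 0 = 1" "of_nat m \<noteq> (0 :: 'a)"
  shows "\<exists>v. v $ 0 = 1 \<and> v ^ m = u"
proof -
  define \<Phi> where "\<Phi> v = (if v $ 0 = 1 then v + fps_const (1 / of_nat m) * (u - v ^ m) else 1)"
    for v :: "'a fps"
  have \<Phi>0: "\<Phi> v $ 0 = 1" for v
    using assms by (simp add: \<Phi>_def fps_nth_power_0)
  have "\<exists>v. \<Phi> v = v"
  proof (rule fps_fixpoint_exists)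
    fix f g :: "'a fps" and n assume fg: "\<And>k. k < n \<Longrightarrow> f $ k = g $ k"
    show "\<Phi> f $ n = \<Phi> g $ n"
    proof (cases "n = 0")
      case False
      then have eq: "f $ 0 = g $ 0" using fg by simp
      show ?thesis
      proof (cases "f $ 0 = 1")
        case True
        then have "(f ^ m) $ n - (g ^ m) $ n = of_nat m * (f $ n - g $ n)"
          using eq fg by (intro power_diff_nth) auto
        then have pow: "(f ^ m) $ n = (g ^ m) $ n + of_nat m * (f $ n - g $ n)"
          by (simp add: algebra_simps)
        have *: "\<Phi> v $ n = v $ n + (u $ n - (v ^ m) $ n) / of_nat m" if "v $ 0 = 1" for v
          using that by (simp add: \<Phi>_def)
        show ?thesis
          using assms(2) True eq by (simp only: * pow) (simp add: field_simps)
      next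
        case False
        then show ?thesis using eq by (simp add: \<Phi>_def)
      qed
    qed (simp add: \<Phi>0)
  qed
  then obtain v where v: "\<Phi> v = v" ..
  have v0: "v $ 0 = 1" using \<Phi>0[of v] v by simp
  then have "fps_const (1 / of_nat m) * (u - v ^ m) = 0"
    using v by (simp add: \<Phi>_def)
  then have "v ^ m = u" using assms(2) by simp
  then show ?thesis using v0 by blast
qed

lemma fps_inv_props:
  fixes s :: "'a::field fps"
  assumes "s $ 0 = 0" "s $ 1 \<noteq> 0"
  shows "fps_inv s $ 0 = 0" "s oo fps_inv s = fps_X" "s $ 1 * fps_inv s $ 1 = 1"
proof -
  show 0: "fps_inv s $ 0 = 0" by (simp add: fps_inv_def)
  show 1: "s oo fps_inv s = fps_X" by (rule fps_inv_right[OF assms])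
  have "(s oo fps_inv s) $ 1 = s $ 1 * fps_inv s $ 1"
    using assms by (simp add: fps_compose_nth)
  then show "s $ 1 * fps_inv s $ 1 = 1" by (simp add: 1)
qed

lemma reparam_to_power:
  fixes x :: "'k::alg_closed_field fps"
  assumes "x $ 0 = 0" "order_ge a x" "x $ a \<noteq> 0" "of_nat a \<noteq> (0 :: 'k)"
  shows "\<exists>r. r $ 0 = 0 \<and> r $ 1 \<noteq> 0 \<and> x oo r = fps_X ^ a"
proof -
  have "a > 0" using assms by (cases a) auto
  obtain \<mu> where \<mu>: "\<mu> ^ a = x $ a" using nth_root_exists[OF \<open>a > 0\<close>] by blast
  have "\<mu> \<noteq> 0" using \<mu> assms(3) \<open>a > 0\<close> by (metis zero_power)
  obtain v where v: "v $ 0 = 1" "v ^ a = fps_const (1 / x $ a) * fps_shift a x"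
    using fps_unit_root[of "fps_const (1 / x $ a) * fps_shift a x" a] assms by auto
  define s where "s = fps_const \<mu> * (fps_X * v)"
  have "s ^ a = fps_const (x $ a) * fps_const (1 / x $ a) * (fps_X ^ a * fps_shift a x)"
    by (simp only: s_def power_mult_distrib v fps_const_power \<mu> mult_ac)
  also have "\<dots> = x"
    using assms(3) order_ge_factor[OF assms(2)] by simp
  finally have s: "s ^ a = x" .
  have s01: "s $ 0 = 0" "s $ 1 \<noteq> 0" using v \<open>\<mu> \<noteq> 0\<close> by (simp_all add: s_def)
  note r = fps_inv_props[OF s01]
  have "x oo fps_inv s = (s oo fps_inv s) ^ a"
    by (simp only: fps_compose_power[OF r(1)] s)
  then have "x oo fps_inv s = fps_X ^ a" by (simp only: r(2))
  then show ?thesis using r by (intro exI[of _ "fps_inv s"]) auto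
qed

lemma order_ge_compose:
  fixes f r :: "'a::comm_ring_1 fps"
  assumes "order_ge n f" "r $ 0 = 0"
  shows "order_ge n (f oo r)" "(f oo r) $ n = f $ n * (r $ 1) ^ n"
proof -
  have r: "order_ge 1 r" using assms by simp
  show "order_ge n (f oo r)"
    using assms(1) by (simp add: fps_compose_nth)
  have "(f oo r) $ n = (\<Sum>i\<in>{n}. f $ i * (r ^ i) $ n)"
    unfolding fps_compose_nth by (rule sum.mono_neutral_right) (use assms(1) in auto)
  then show "(f oo r) $ n = f $ n * (r $ 1) ^ n"
    using order_ge_power(2)[OF r, of n] by simp
qed

text \<open>
  Solving \<open>(t\<^sup>m + h)(r(t)) = t\<^sup>m\<close> gives \<open>r = t - (\<eta> / m) t\<^sup>k\<^sup>+\<^sup>1 + \<dots>\<close>, where \<open>\<eta>\<close> is the coefficient of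
  \<open>t\<^sup>m\<^sup>+\<^sup>k\<close> in \<open>h\<close>. In a series of order \<open>n\<close> this changes no coefficient below degree \<open>n + k\<close>, and that one
  by the first-order term.
\<close>

lemma reparam_shift:
  fixes h :: "'k::field fps"
  assumes "of_nat m \<noteq> (0 :: 'k)" "0 < k" "order_ge (m + k) h"
  shows "\<exists>r. r $ 0 = 0 \<and> r $ 1 \<noteq> 0 \<and> (fps_X ^ m + h) oo r = fps_X ^ m \<and>
    (\<forall>v n. order_ge n v \<longrightarrow> (\<forall>i<n + k. (v oo r) $ i = v $ i) \<and>
      (v oo r) $ (n + k) = v $ (n + k) - of_nat n / of_nat m * v $ n * h $ (m + k))"
proof -
  define h' where "h' = fps_shift m h"
  have h: "h = fps_X ^ m * h'"
    using assms(3) order_ge_factor[of m h] by (simp add: h'_def)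
  have h': "order_ge k h'" "h' $ k = h $ (m + k)"
    using assms(3) by (simp_all add: h'_def add.commute)
  obtain w where w: "w $ 0 = 1" "w ^ m = 1 + h'"
    using fps_unit_root[of "1 + h'" m] assms h' by auto
  have w_nth: "of_nat m * (w $ i - 1 $ i) = h' $ i" if "order_ge i (w - 1)" for i
    using power_diff_nth[OF w(1) _ that, of m] w(2) by simp
  have w1: "order_ge i (w - 1)" if "i \<le> k" for i
    using that
  proof (induction i)
    case (Suc i)
    then have "order_ge i (w - 1)" "h' $ i = 0" using h' by auto
    then have "(w - 1) $ i = 0" using w_nth[of i] assms(1) by simp
    then show ?case using \<open>order_ge i (w - 1)\<close> by (auto simp: less_Suc_eq)
  qed simp
  have wk: "(w - 1) $ k = h $ (m + k) / of_nat m"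
    using w_nth[OF w1[OF order_refl]] assms(1) h'(2) by (simp add: field_simps)
  \<comment> \<open>The \<open>m\<close>-th root of \<open>t ^ m + h\<close> is the inverse of the desired reparameterization.\<close>
  define s where "s = fps_X * w"
  have s: "s ^ m = fps_X ^ m + h"
    by (simp add: s_def power_mult_distrib w h algebra_simps)
  have s01: "s $ 0 = 0" "s $ 1 = 1" using w by (simp_all add: s_def)
  define r where "r = fps_inv s"
  have r: "r $ 0 = 0" "s oo r = fps_X" "r $ 1 = 1"
    using fps_inv_props[of s] s01 by (simp_all add: r_def)
  have power: "(fps_X ^ m + h) oo r = fps_X ^ m"
    by (metis fps_compose_power r(1,2) s)
  define d where "d = (w - 1) oo r"
  have d: "order_ge k d" "d $ k = h $ (m + k) / of_nat m"
    using order_ge_compose[OF w1[OF order_refl] r(1)] by (simp_all only: d_def wk r) simp_all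
  \<comment> \<open>With \<open>r = t \<rho>\<close> the equation \<open>s(r(t)) = t\<close> reads \<open>\<rho> (1 + d) = 1\<close>.\<close>
  define \<rho> where "\<rho> = fps_shift 1 r"
  have r\<rho>: "r = fps_X * \<rho>" using order_ge_factor[of 1 r] r by (simp add: \<rho>_def)
  have "\<rho> - 1 = - (\<rho> * d)"
  proof -
    have "fps_X = s oo r" by (simp only: r)
    also have "\<dots> = r * (w oo r)"
      using r(1) by (simp add: s_def fps_compose_mult_distrib)
    also have "w oo r = 1 + d" by (simp add: d_def fps_compose_sub_distrib)
    finally have "fps_X * 1 = fps_X * (\<rho> * (1 + d))" by (simp add: r\<rho> mult.assoc)
    then have "1 = \<rho> * (1 + d)" by (metis fps_X_neq_zero mult_left_cancel)
    then show ?thesis by (simp add: algebra_simps)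
  qed
  moreover have \<rho>0: "\<rho> $ 0 = 1" using r by (simp add: \<rho>_def)
  ultimately have \<rho>1: "order_ge k (\<rho> - 1)" and \<rho>k: "(\<rho> - 1) $ k = - d $ k"
    using order_ge_mult[OF _ d(1), of 0 \<rho>] by simp_all
  have r_power: "(r ^ j) $ i = (if i = j then 1 else 0)
      - (if i = j + k then of_nat j * (h $ (m + k) / of_nat m) else 0)" if "i \<le> j + k" "j \<le> i" for i j
  proof -
    have "(r ^ j) $ i = (\<rho> ^ j) $ (i - j)"
      using that by (simp add: r\<rho> power_mult_distrib fps_X_power_mult_nth)
    also have "\<dots> = (1 ^ j) $ (i - j) + of_nat j * (\<rho> $ (i - j) - 1 $ (i - j))"
      using power_diff_nth[OF \<rho>0, of 1 "i - j" j] \<rho>1 that by (simp add: algebra_simps)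
    also have "\<rho> $ (i - j) - 1 $ (i - j) = (\<rho> - 1) $ (i - j)" by simp
    also have "\<dots> = (if i = j + k then - (h $ (m + k) / of_nat m) else 0)"
      using that \<rho>1 \<rho>k d(2) by auto
    finally show ?thesis using assms(2) that by (auto split: if_splits)
  qed
  have "(v oo r) $ i = v $ i
      - (if i = n + k then of_nat n / of_nat m * v $ n * h $ (m + k) else 0)"
    if v: "order_ge n v" and i: "i \<le> n + k" for v n i
  proof -
    have "(v oo r) $ i = (\<Sum>j=0..i. (if j = i then v $ i else 0)
        - (if j = n then if i = n + k then of_nat n / of_nat m * v $ n * h $ (m + k) else 0 else 0))"
      unfolding fps_compose_nth
    proof (rule sum.cong[OF refl])
      fix j assume j: "j \<in> {0..i}"
      show "v $ j * (r ^ j) $ i = (if j = i then v $ i else 0)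
        - (if j = n then if i = n + k then of_nat n / of_nat m * v $ n * h $ (m + k) else 0 else 0)"
      proof (cases "j < n")
        case True
        then show ?thesis using v by auto
      next
        case False
        then show ?thesis using r_power[of i j] i j assms(2) by auto
      qed
    qed
    also have "\<dots> = v $ i - (if i = n + k then of_nat n / of_nat m * v $ n * h $ (m + k) else 0)"
      by (simp add: sum_subtractf)
    finally show ?thesis .
  qed
  then show ?thesis
    using r power by (intro exI[of _ r]) (auto simp: less_imp_le)
qed

section \<open>Elementary moves\<close>

lemma A_equiv_refl: "x $ 0 = 0 \<Longrightarrow> y $ 0 = 0 \<Longrightarrow> (x, y) \<sim>\<^sub>A (x, y)"
  by (rule A_equiv_coords[of "fps_const fps_X" fps_X]) (simp_all add: coord_change_def)

context plane_pair
begin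

lemma A_equiv_change_fst:
  assumes "H $ 0 $ 0 = 0" "H $ 0 $ 1 = 0" "k \<noteq> 0"
  shows "(x, y) \<sim>\<^sub>A (fps_const k * x + subst2 H (x, y), y)"
  by (rule A_equiv_coords[of "fps_const (fps_const k * fps_X) + H" fps_X])
    (use assms in \<open>simp_all add: coord_change_def subst2_add fps_compose_mult_distrib\<close>)

lemma A_equiv_change_snd:
  assumes "H $ 0 $ 0 = 0" "H $ 1 $ 0 = 0" "k \<noteq> 0"
  shows "(x, y) \<sim>\<^sub>A (x, fps_const k * y + subst2 H (x, y))"
  by (rule A_equiv_coords[of "fps_const fps_X" "fps_const (fps_const k) * fps_X + H"])
    (use assms in \<open>simp_all add: coord_change_def subst2_add subst2_mult\<close>)

end

text \<open>
  Each move keeps the branch in normal position and its semigroup, so the next move may use the same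
  exponents.
\<close>

lemma branch_transfer:
  assumes "branch x y a b" "(x, y) \<sim>\<^sub>A (x', y')"
    and "order_ge a x'" "x' $ a \<noteq> 0" "order_ge b y'" "y' $ b \<noteq> 0"
  shows "branch x' y' a b" "semigroup_of (x', y') = semigroup_of (x, y)"
proof -
  interpret branch x y a b by fact
  show eq: "semigroup_of (x', y') = semigroup_of (x, y)"
    by (rule semigroup_A_equiv) (use assms in auto)
  show "branch x' y' a b"
  proof
    show "x' $ 0 = 0" "y' $ 0 = 0" using A_equiv_zero[OF _ _ assms(2)] by auto
    show "subdegree x' = a" "subdegree y' = b" using assms by (auto intro: subdegreeI)
    show "x' \<noteq> 0" "y' \<noteq> 0" using assms by auto
  qed (use a_less_b a_ndvd_b finite_gaps eq in auto)
qed

context branch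
begin

lemma change_fst:
  assumes "h \<in> R" "order_ge (Suc a) h" "k \<noteq> 0"
  shows "(x, y) \<sim>\<^sub>A (fps_const k * x + h, y)"
proof -
  obtain H where "h = subst2 H (x, y)" using assms by (auto simp: ring_iff)
  then show ?thesis
    using A_equiv_change_fst[OF no_X_term[of H] assms(3)] assms(2) by auto
qed

lemma change_snd:
  assumes "h \<in> R" "order_ge (Suc b) h" "k \<noteq> 0"
  shows "(x, y) \<sim>\<^sub>A (x, fps_const k * y + h)"
proof -
  obtain H where "h = subst2 H (x, y)" using assms by (auto simp: ring_iff)
  then show ?thesis
    using A_equiv_change_snd[OF no_Y_term[of H] assms(3)] assms(2) by auto
qed

lemma eliminate:
  assumes "order_ge n f" "f $ n \<noteq> 0"
  obtains h \<alpha> where "h \<in> R" "order_ge (Suc n) h"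
    "fps_const (1 / f $ n) * f + h = fps_X ^ n + series_on {i. n < i \<and> i \<notin> \<Gamma>} \<alpha>"
proof -
  define g where "g = fps_const (1 / f $ n) * f - fps_X ^ n"
  have g: "order_ge (Suc n) g"
    using assms by (auto simp: g_def less_Suc_eq)
  obtain h where h: "h \<in> R" "order_ge (Suc n) h" "\<And>i. i \<in> \<Gamma> \<Longrightarrow> (g - h) $ i = 0"
    using reduce[OF g] by blast
  have "g - h = series_on {i. n < i \<and> i \<notin> \<Gamma>} (\<lambda>i. (g - h) $ i)"
    using g h(2,3) by (auto simp: fps_eq_iff series_on_def not_less simp flip: less_Suc_eq_le)
  moreover have "fps_const (1 / f $ n) * f + (- h) = fps_X ^ n + (g - h)"
    by (simp add: g_def)
  ultimately have "fps_const (1 / f $ n) * f + (- h)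
      = fps_X ^ n + series_on {i. n < i \<and> i \<notin> \<Gamma>} (\<lambda>i. (g - h) $ i)"
    by metis
  moreover have "- h \<in> R" using ring_diff[of 0 h] h by auto
  ultimately show thesis using that h(2) by auto
qed

lemma reduce_fst:
  obtains \<alpha> where "(x, y) \<sim>\<^sub>A (fps_X ^ a + series_on {i. a < i \<and> i \<notin> \<Gamma>} \<alpha>, y)"
proof -
  obtain h \<alpha> where h: "h \<in> R" "order_ge (Suc a) h"
    and eq: "fps_const (1 / x $ a) * x + h = fps_X ^ a + series_on {i. a < i \<and> i \<notin> \<Gamma>} \<alpha>"
    by (rule eliminate[OF order_x x_a])
  have "(x, y) \<sim>\<^sub>A (fps_const (1 / x $ a) * x + h, y)"
    by (rule change_fst[OF h]) simp
  then show thesis unfolding eq by (rule that)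
qed

lemma reduce_snd:
  obtains \<beta> where "(x, y) \<sim>\<^sub>A (x, fps_X ^ b + series_on {i. b < i \<and> i \<notin> \<Gamma>} \<beta>)"
proof -
  obtain h \<beta> where h: "h \<in> R" "order_ge (Suc b) h"
    and eq: "fps_const (1 / y $ b) * y + h = fps_X ^ b + series_on {i. b < i \<and> i \<notin> \<Gamma>} \<beta>"
    by (rule eliminate[OF order_y y_b])
  have "(x, y) \<sim>\<^sub>A (x, fps_const (1 / y $ b) * y + h)"
    by (rule change_snd[OF h]) simp
  then show thesis unfolding eq by (rule that)
qed

text \<open>
  Above the conductor everything can be dropped.
\<close>

lemma truncate_snd:
  assumes "b < c"
  shows "(x, y) \<sim>\<^sub>A (x, Abs_fps (\<lambda>i. if i < c then y $ i else 0))"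
proof -
  define t where "t = Abs_fps (\<lambda>i. if i < c then 0 else - y $ i)"
  have "t \<in> R" by (rule tail_in_ring) (simp add: t_def)
  then have "(x, y) \<sim>\<^sub>A (x, fps_const 1 * y + t)"
    by (rule change_snd) (use assms in \<open>simp_all add: t_def\<close>)
  also have "fps_const 1 * y + t = Abs_fps (\<lambda>i. if i < c then y $ i else 0)"
    by (simp add: t_def fps_eq_iff)
  finally show ?thesis .
qed

lemma truncate_fst:
  assumes "a < c"
  shows "(x, y) \<sim>\<^sub>A (Abs_fps (\<lambda>i. if i < c then x $ i else 0), y)"
proof -
  define t where "t = Abs_fps (\<lambda>i. if i < c then 0 else - x $ i)"
  have "t \<in> R" by (rule tail_in_ring) (simp add: t_def)
  then have "(x, y) \<sim>\<^sub>A (fps_const 1 * x + t, y)"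
    by (rule change_fst) (use assms in \<open>simp_all add: t_def\<close>)
  also have "fps_const 1 * x + t = Abs_fps (\<lambda>i. if i < c then x $ i else 0)"
    by (simp add: t_def fps_eq_iff)
  finally show ?thesis .
qed

end

lemma order_monic_series:
  assumes "S \<subseteq> {n<..}"
  shows "order_ge n (fps_X ^ n + series_on S \<alpha>)" "(fps_X ^ n + series_on S \<alpha>) $ n = 1"
  using assms by (auto simp: series_on_def)

lemma series_below_conductor:
  assumes "order_ge n f" "f $ n = 1" "\<And>i. i \<in> \<Gamma> \<Longrightarrow> n < i \<Longrightarrow> i < c - 1 \<Longrightarrow> f $ i = 0"
    and "\<And>i. n < i \<Longrightarrow> c - 1 \<le> i \<Longrightarrow> f $ i = 0"
  shows "\<exists>\<alpha>. f = fps_X ^ n + series_on {i. n < i \<and> i \<notin> \<Gamma> \<and> i < c - 1} \<alpha>"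
proof (rule exI, rule fps_ext)
  show "f $ i = (fps_X ^ n + series_on {i. n < i \<and> i \<notin> \<Gamma> \<and> i < c - 1} (\<lambda>i. f $ i)) $ i" for i
  proof -
    consider "i < n" | "i = n" | "n < i" "i < c - 1" | "n < i" "c - 1 \<le> i" by linarith
    then show ?thesis
      using assms(1,2) assms(3,4)[of i] by cases (auto simp: series_on_def)
  qed
qed

context branch
begin

text \<open>
  By symmetry there is \<open>h\<close> in the ring of order \<open>c - 1 - (b - a) = a + k\<close>, where \<open>b + k = c - 1\<close>. Adding a
  multiple of \<open>h\<close> to \<open>x = t\<^sup>a\<close> and reparameterizing back to \<open>t\<^sup>a\<close> changes \<open>y\<close> first in degree \<open>b + k\<close>. The
  terms that this creates beyond \<open>c - 1\<close> are dropped.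
\<close>

lemma remove_top_gap_snd:
  assumes "x = fps_X ^ a" "y $ b = 1" "\<And>i. i \<in> \<Gamma> \<Longrightarrow> b < i \<Longrightarrow> y $ i = 0"
    and "of_nat a \<noteq> (0 :: 'a)" "of_nat b \<noteq> (0 :: 'a)"
  shows "\<exists>\<beta>. (x, y) \<sim>\<^sub>A (fps_X ^ a, fps_X ^ b + series_on {i. b < i \<and> i \<notin> \<Gamma> \<and> i < c - 1} \<beta>)"
proof (cases "b < c - 1")
  case False
  then have "y $ i = 0" if "b < i" for i
    using that in_semigroup[of i] assms(3) by simp
  then have "\<exists>\<beta>. y = fps_X ^ b + series_on {i. b < i \<and> i \<notin> \<Gamma> \<and> i < c - 1} \<beta>"
    using order_y assms(2) by (intro series_below_conductor) auto
  then obtain \<beta> where eq: "y = fps_X ^ b + series_on {i. b < i \<and> i \<notin> \<Gamma> \<and> i < c - 1} \<beta>"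
    by blast
  show ?thesis
    by (rule exI[of _ \<beta>], fold eq assms(1)) (rule A_equiv_refl[OF x_0 y_0])
next
  case True
  define k where "k = c - 1 - b"
  have k: "0 < k" "b + k = c - 1" using True by (auto simp: k_def)
  have "c - 1 - (b - a) \<in> \<Gamma>"
    using semigroup_symmetric[OF _ diff_notin_semigroup] True by simp
  moreover have "c - 1 - (b - a) = a + k"
    using True a_less_b unfolding k_def by arith
  ultimately have "a + k \<in> \<Gamma>" by simp
  then obtain h where h: "h \<in> R" "order_ge (a + k) h" "h $ (a + k) = 1"
    by (rule monic_element)
  \<comment> \<open>Chosen so that the first-order change \<open>- (b / a) \<epsilon>\<close> of \<open>y\<close> in degree \<open>c - 1\<close> cancels its coefficient.\<close>
  define \<epsilon> where "\<epsilon> = of_nat a / of_nat b * y $ (c - 1)"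
  define h' where "h' = fps_const \<epsilon> * h"
  have h': "h' \<in> R" "order_ge (a + k) h'" "h' $ (a + k) = \<epsilon>"
    using h by (auto simp: h'_def)
  have "(x, y) \<sim>\<^sub>A (fps_const 1 * x + h', y)"
    using h' k by (intro change_fst) auto
  then have 1: "(x, y) \<sim>\<^sub>A (fps_X ^ a + h', y)" using assms(1) by simp
  obtain r where r: "r $ 0 = 0" "r $ 1 \<noteq> 0" "(fps_X ^ a + h') oo r = fps_X ^ a"
    and shift: "\<And>v n. order_ge n v \<Longrightarrow> (\<forall>i<n + k. (v oo r) $ i = v $ i) \<and>
      (v oo r) $ (n + k) = v $ (n + k) - of_nat n / of_nat a * v $ n * h' $ (a + k)"
    using reparam_shift[OF assms(4) k(1) h'(2)] by blast
  have "(fps_X ^ a + h') $ 0 = 0" using A_equiv_zero[OF _ _ 1] by simp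
  then have 2: "(fps_X ^ a + h', y) \<sim>\<^sub>A (x, y oo r)"
    using A_equiv_reparam[of "fps_X ^ a + h'" y r] r assms(1) by simp
  define y2 where "y2 = y oo r"
  have 3: "(x, y) \<sim>\<^sub>A (x, y2)"
    unfolding y2_def by (rule A_equiv_trans[OF x_0 y_0 1 2])
  have y2_less: "y2 $ i = y $ i" if "i < c - 1" for i
    using shift[OF order_y] that by (simp add: y2_def k)
  have y2_top: "y2 $ (c - 1) = 0"
    using shift[OF order_y] assms by (simp add: y2_def k h' \<epsilon>_def)
  have y2_order: "order_ge b y2" "y2 $ b = 1"
    using order_y y2_less True assms(2) by auto
  have tr: "branch x y2 a b" "semigroup_of (x, y2) = \<Gamma>"
    by (rule branch_transfer[OF branch_axioms 3]; use order_x y2_order in simp)+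
  interpret new: branch x y2 a b by (rule tr)
  define y3 where "y3 = Abs_fps (\<lambda>i. if i < c then y2 $ i else 0)"
  have "(x, y2) \<sim>\<^sub>A (x, y3)"
    using new.truncate_snd True by (simp add: tr(2) y3_def)
  then have 4: "(x, y) \<sim>\<^sub>A (x, y3)"
    by (rule A_equiv_trans[OF x_0 y_0 3])
  have "\<exists>\<beta>. y3 = fps_X ^ b + series_on {i. b < i \<and> i \<notin> \<Gamma> \<and> i < c - 1} \<beta>"
  proof (rule series_below_conductor)
    show "order_ge b y3" "y3 $ b = 1" using y2_order True by (simp_all add: y3_def)
    show "y3 $ i = 0" if "i \<in> \<Gamma>" "b < i" "i < c - 1" for i
      using that assms(3) y2_less by (simp add: y3_def)
    show "y3 $ i = 0" if "c - 1 \<le> i" for i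
      using that y2_top by (cases "i = c - 1") (auto simp: y3_def)
  qed
  then show ?thesis using 4 unfolding assms(1) by blast
qed

text \<open>
  Here the correction has order \<open>c - 1 + (b - a) \<ge> c\<close>, so it lies in the ring automatically.
\<close>

lemma remove_top_gap_fst:
  assumes "y = fps_X ^ b" "x $ a = 1" "\<And>i. i \<in> \<Gamma> \<Longrightarrow> a < i \<Longrightarrow> x $ i = 0"
    and "of_nat a \<noteq> (0 :: 'a)" "of_nat b \<noteq> (0 :: 'a)"
  shows "\<exists>\<alpha>. (x, y) \<sim>\<^sub>A (fps_X ^ a + series_on {i. a < i \<and> i \<notin> \<Gamma> \<and> i < c - 1} \<alpha>, fps_X ^ b)"
proof (cases "a < c - 1")
  case False
  then have "x $ i = 0" if "a < i" for i
    using that in_semigroup[of i] assms(3) by simp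
  then have "\<exists>\<alpha>. x = fps_X ^ a + series_on {i. a < i \<and> i \<notin> \<Gamma> \<and> i < c - 1} \<alpha>"
    using order_x assms(2) by (intro series_below_conductor) auto
  then obtain \<alpha> where eq: "x = fps_X ^ a + series_on {i. a < i \<and> i \<notin> \<Gamma> \<and> i < c - 1} \<alpha>"
    by blast
  show ?thesis
    by (rule exI[of _ \<alpha>], fold eq assms(1)) (rule A_equiv_refl[OF x_0 y_0])
next
  case True
  define k where "k = c - 1 - a"
  have k: "0 < k" "a + k = c - 1" using True by (auto simp: k_def)
  have "c \<le> b + k" using k a_less_b by simp
  define \<epsilon> where "\<epsilon> = of_nat b / of_nat a * x $ (c - 1)"
  define h' where "h' = fps_const \<epsilon> * fps_X ^ (b + k)"
  have h': "order_ge (b + k) h'" "h' $ (b + k) = \<epsilon>"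
    by (auto simp: h'_def)
  have "h' \<in> R" using h'(1) \<open>c \<le> b + k\<close> by (intro tail_in_ring) auto
  then have "(x, y) \<sim>\<^sub>A (x, fps_const 1 * y + h')"
    using h' k by (intro change_snd) auto
  then have 1: "(x, y) \<sim>\<^sub>A (x, fps_X ^ b + h')" using assms(1) by simp
  obtain r where r: "r $ 0 = 0" "r $ 1 \<noteq> 0" "(fps_X ^ b + h') oo r = fps_X ^ b"
    and shift: "\<And>v n. order_ge n v \<Longrightarrow> (\<forall>i<n + k. (v oo r) $ i = v $ i) \<and>
      (v oo r) $ (n + k) = v $ (n + k) - of_nat n / of_nat b * v $ n * h' $ (b + k)"
    using reparam_shift[OF assms(5) k(1) h'(1)] by blast
  have "(fps_X ^ b + h') $ 0 = 0" using A_equiv_zero[OF _ _ 1] by simp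
  then have 2: "(x, fps_X ^ b + h') \<sim>\<^sub>A (x oo r, y)"
    using A_equiv_reparam[of x "fps_X ^ b + h'" r] r assms(1) by simp
  define x2 where "x2 = x oo r"
  have 3: "(x, y) \<sim>\<^sub>A (x2, y)"
    unfolding x2_def by (rule A_equiv_trans[OF x_0 y_0 1 2])
  have x2_less: "x2 $ i = x $ i" if "i < c - 1" for i
    using shift[OF order_x] that by (simp add: x2_def k)
  have x2_top: "x2 $ (c - 1) = 0"
    using shift[OF order_x] assms by (simp add: x2_def k h' \<epsilon>_def)
  have x2_order: "order_ge a x2" "x2 $ a = 1"
    using order_x x2_less True assms(2) by auto
  have tr: "branch x2 y a b" "semigroup_of (x2, y) = \<Gamma>"
    by (rule branch_transfer[OF branch_axioms 3]; use order_y x2_order in simp)+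
  interpret new: branch x2 y a b by (rule tr)
  define x3 where "x3 = Abs_fps (\<lambda>i. if i < c then x2 $ i else 0)"
  have "(x2, y) \<sim>\<^sub>A (x3, y)"
    using new.truncate_fst True by (simp add: tr(2) x3_def)
  then have 4: "(x, y) \<sim>\<^sub>A (x3, y)"
    by (rule A_equiv_trans[OF x_0 y_0 3])
  have "\<exists>\<alpha>. x3 = fps_X ^ a + series_on {i. a < i \<and> i \<notin> \<Gamma> \<and> i < c - 1} \<alpha>"
  proof (rule series_below_conductor)
    show "order_ge a x3" "x3 $ a = 1" using x2_order True by (simp_all add: x3_def)
    show "x3 $ i = 0" if "i \<in> \<Gamma>" "a < i" "i < c - 1" for i
      using that assms(3) x2_less by (simp add: x3_def)
    show "x3 $ i = 0" if "c - 1 \<le> i" for i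
      using that x2_top by (cases "i = c - 1") (auto simp: x3_def)
  qed
  then show ?thesis using 4 unfolding assms(1) by blast
qed

end

section \<open>Normal forms\<close>

text \<open>
  Over an algebraically closed field the leading coefficient of a component has the root needed to
  reparameterize that component to a power of \<open>t\<close>.
\<close>

locale branch_closed = branch x y a b
  for x y :: "'k::alg_closed_field fps" and a b
begin

lemma normal_form:
  "\<exists>\<alpha> \<beta>. (x, y) \<sim>\<^sub>A (fps_X ^ a + series_on {i. a < i \<and> i \<notin> \<Gamma>} \<alpha>,
                    fps_X ^ b + series_on {i. b < i \<and> i \<notin> \<Gamma>} \<beta>)"
proof -
  obtain \<alpha> where \<alpha>: "(x, y) \<sim>\<^sub>A (fps_X ^ a + series_on {i. a < i \<and> i \<notin> \<Gamma>} \<alpha>, y)"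
    by (rule reduce_fst)
  define x' where "x' = fps_X ^ a + series_on {i. a < i \<and> i \<notin> \<Gamma>} \<alpha>"
  have x': "order_ge a x'" "x' $ a = 1"
    unfolding x'_def by (rule order_monic_series; auto)+
  have tr: "branch x' y a b" "semigroup_of (x', y) = \<Gamma>"
    by (rule branch_transfer[OF branch_axioms \<alpha>[folded x'_def]]; use x' order_y in simp)+
  interpret new: branch x' y a b by (rule tr)
  obtain \<beta> where "(x', y) \<sim>\<^sub>A (x', fps_X ^ b + series_on {i. b < i \<and> i \<notin> \<Gamma>} \<beta>)"
    using new.reduce_snd unfolding tr(2) by blast
  then have "(x, y) \<sim>\<^sub>A (x', fps_X ^ b + series_on {i. b < i \<and> i \<notin> \<Gamma>} \<beta>)"
    by (rule A_equiv_trans[OF x_0 y_0 \<alpha>[folded x'_def]])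
  then show ?thesis unfolding x'_def by blast
qed

lemma normal_form_power_fst:
  assumes "of_nat a \<noteq> (0 :: 'k)"
  shows "\<exists>\<beta>. (x, y) \<sim>\<^sub>A (fps_X ^ a, fps_X ^ b + series_on {i. b < i \<and> i \<notin> \<Gamma>} \<beta>)"
proof -
  obtain r where r: "r $ 0 = 0" "r $ 1 \<noteq> 0" "x oo r = fps_X ^ a"
    using reparam_to_power[OF x_0 order_x x_a assms] by blast
  have 1: "(x, y) \<sim>\<^sub>A (fps_X ^ a, y oo r)"
    using A_equiv_reparam[OF x_0 y_0 r(1,2)] r(3) by simp
  have tr: "branch (fps_X ^ a) (y oo r) a b" "semigroup_of (fps_X ^ a, y oo r) = \<Gamma>"
    by (rule branch_transfer[OF branch_axioms 1]; use order_ge_compose[OF order_y r(1)] r(2) in simp)+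
  interpret new: branch "fps_X ^ a" "y oo r" a b by (rule tr)
  obtain \<beta> where "(fps_X ^ a, y oo r) \<sim>\<^sub>A (fps_X ^ a, fps_X ^ b + series_on {i. b < i \<and> i \<notin> \<Gamma>} \<beta>)"
    using new.reduce_snd unfolding tr(2) by blast
  then show ?thesis using A_equiv_trans[OF x_0 y_0 1] by blast
qed

lemma normal_form_power_snd:
  assumes "of_nat b \<noteq> (0 :: 'k)"
  shows "\<exists>\<alpha>. (x, y) \<sim>\<^sub>A (fps_X ^ a + series_on {i. a < i \<and> i \<notin> \<Gamma>} \<alpha>, fps_X ^ b)"
proof -
  obtain r where r: "r $ 0 = 0" "r $ 1 \<noteq> 0" "y oo r = fps_X ^ b"
    using reparam_to_power[OF y_0 order_y y_b assms] by blast
  have 1: "(x, y) \<sim>\<^sub>A (x oo r, fps_X ^ b)"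
    using A_equiv_reparam[OF x_0 y_0 r(1,2)] r(3) by simp
  have tr: "branch (x oo r) (fps_X ^ b) a b" "semigroup_of (x oo r, fps_X ^ b) = \<Gamma>"
    by (rule branch_transfer[OF branch_axioms 1]; use order_ge_compose[OF order_x r(1)] r(2) in simp)+
  interpret new: branch "x oo r" "fps_X ^ b" a b by (rule tr)
  obtain \<alpha> where "(x oo r, fps_X ^ b) \<sim>\<^sub>A (fps_X ^ a + series_on {i. a < i \<and> i \<notin> \<Gamma>} \<alpha>, fps_X ^ b)"
    using new.reduce_fst unfolding tr(2) by blast
  then show ?thesis using A_equiv_trans[OF x_0 y_0 1] by blast
qed

lemma short_normal_form_power_fst:
  assumes "of_nat a \<noteq> (0 :: 'k)" "of_nat b \<noteq> (0 :: 'k)"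
  shows "\<exists>\<beta>. (x, y) \<sim>\<^sub>A (fps_X ^ a, fps_X ^ b + series_on {i. b < i \<and> i \<notin> \<Gamma> \<and> i < c - 1} \<beta>)"
proof -
  obtain \<beta> where 1: "(x, y) \<sim>\<^sub>A (fps_X ^ a, fps_X ^ b + series_on {i. b < i \<and> i \<notin> \<Gamma>} \<beta>)"
    using normal_form_power_fst[OF assms(1)] by blast
  define y' where "y' = fps_X ^ b + series_on {i. b < i \<and> i \<notin> \<Gamma>} \<beta>"
  have y': "order_ge b y'" "y' $ b = 1"
    unfolding y'_def by (rule order_monic_series; auto)+
  have tr: "branch (fps_X ^ a) y' a b" "semigroup_of (fps_X ^ a, y') = \<Gamma>"
    by (rule branch_transfer[OF branch_axioms 1[folded y'_def]]; use y' in simp)+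
  interpret new: branch "fps_X ^ a" y' a b by (rule tr)
  have "y' $ i = 0" if "i \<in> \<Gamma>" "b < i" for i
    using that by (simp add: y'_def series_on_def)
  then obtain \<gamma> where "(fps_X ^ a, y') \<sim>\<^sub>A
      (fps_X ^ a, fps_X ^ b + series_on {i. b < i \<and> i \<notin> \<Gamma> \<and> i < c - 1} \<gamma>)"
    using new.remove_top_gap_snd[OF refl y'(2) _ assms] unfolding tr(2) by blast
  then show ?thesis using A_equiv_trans[OF x_0 y_0 1[folded y'_def]] by blast
qed

lemma short_normal_form_power_snd:
  assumes "of_nat a \<noteq> (0 :: 'k)" "of_nat b \<noteq> (0 :: 'k)"
  shows "\<exists>\<alpha>. (x, y) \<sim>\<^sub>A (fps_X ^ a + series_on {i. a < i \<and> i \<notin> \<Gamma> \<and> i < c - 1} \<alpha>, fps_X ^ b)"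
proof -
  obtain \<alpha> where 1: "(x, y) \<sim>\<^sub>A (fps_X ^ a + series_on {i. a < i \<and> i \<notin> \<Gamma>} \<alpha>, fps_X ^ b)"
    using normal_form_power_snd[OF assms(2)] by blast
  define x' where "x' = fps_X ^ a + series_on {i. a < i \<and> i \<notin> \<Gamma>} \<alpha>"
  have x': "order_ge a x'" "x' $ a = 1"
    unfolding x'_def by (rule order_monic_series; auto)+
  have tr: "branch x' (fps_X ^ b) a b" "semigroup_of (x', fps_X ^ b) = \<Gamma>"
    by (rule branch_transfer[OF branch_axioms 1[folded x'_def]]; use x' in simp)+
  interpret new: branch x' "fps_X ^ b" a b by (rule tr)
  have "x' $ i = 0" if "i \<in> \<Gamma>" "a < i" for i
    using that by (simp add: x'_def series_on_def)
  then obtain \<gamma> where "(x', fps_X ^ b) \<sim>\<^sub>A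
      (fps_X ^ a + series_on {i. a < i \<and> i \<notin> \<Gamma> \<and> i < c - 1} \<gamma>, fps_X ^ b)"
    using new.remove_top_gap_fst[OF refl x'(2) _ assms] unfolding tr(2) by blast
  then show ?thesis using A_equiv_trans[OF x_0 y_0 1[folded x'_def]] by blast
qed

lemma both_short_normal_forms:
  assumes "of_nat a \<noteq> (0 :: 'k)" "of_nat b \<noteq> (0 :: 'k)"
  shows "\<exists>\<alpha> \<beta>. (x, y) \<sim>\<^sub>A (fps_X ^ a, fps_X ^ b + series_on {i. b < i \<and> i \<notin> \<Gamma> \<and> i < c - 1} \<beta>) \<and>
    (fps_X ^ a, fps_X ^ b + series_on {i. b < i \<and> i \<notin> \<Gamma> \<and> i < c - 1} \<beta>) \<sim>\<^sub>A
    (fps_X ^ a + series_on {i. a < i \<and> i \<notin> \<Gamma> \<and> i < c - 1} \<alpha>, fps_X ^ b)"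
proof -
  obtain \<beta> where 1: "(x, y) \<sim>\<^sub>A (fps_X ^ a, fps_X ^ b + series_on {i. b < i \<and> i \<notin> \<Gamma> \<and> i < c - 1} \<beta>)"
    using short_normal_form_power_fst[OF assms] by blast
  define y' where "y' = fps_X ^ b + series_on {i. b < i \<and> i \<notin> \<Gamma> \<and> i < c - 1} \<beta>"
  have y': "order_ge b y'" "y' $ b = 1"
    unfolding y'_def by (rule order_monic_series; auto)+
  have tr: "branch (fps_X ^ a) y' a b" "semigroup_of (fps_X ^ a, y') = \<Gamma>"
    by (rule branch_transfer[OF branch_axioms 1[folded y'_def]]; use y' in simp)+
  interpret new: branch_closed "fps_X ^ a" y' a b
    by (intro branch_closed.intro tr)
  obtain \<alpha> where 2: "(fps_X ^ a, y') \<sim>\<^sub>A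
      (fps_X ^ a + series_on {i. a < i \<and> i \<notin> \<Gamma> \<and> i < c - 1} \<alpha>, fps_X ^ b)"
    using new.short_normal_form_power_snd[OF assms] unfolding tr(2) by blast
  show ?thesis
    by (rule exI[of _ \<alpha>], rule exI[of _ \<beta>]) (rule conjI[OF 1 2[unfolded y'_def]])
qed

end

context plane_pair
begin

text \<open>
  The series \<open>f\<close> is found coefficient by coefficient: the \<open>k\<close>-th one is determined by the coefficient at
  \<open>k a\<close>, to which \<open>x\<^sup>k\<close> contributes its leading term.
\<close>

lemma remove_powers_of_x:
  assumes "x $ a \<noteq> 0" "order_ge a x" "0 < a"
  shows "\<exists>f. \<forall>k. (y - (f oo x)) $ (k * a) = 0"
proof -
  define \<Phi> where "\<Phi> f = Abs_fps (\<lambda>k. f $ k + (y - (f oo x)) $ (k * a) / (x $ a) ^ k)" for f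
  have "\<exists>f. \<Phi> f = f"
  proof (rule fps_fixpoint_exists)
    fix f g :: "'k fps" and n assume fg: "\<And>k. k < n \<Longrightarrow> f $ k = g $ k"
    have "((f - g) oo x) $ (n * a) = (\<Sum>i\<in>{n}. (f - g) $ i * (x ^ i) $ (n * a))"
      unfolding fps_compose_nth
    proof (rule sum.mono_neutral_right)
      show "\<forall>i\<in>{0..n * a} - {n}. (f - g) $ i * (x ^ i) $ (n * a) = 0"
      proof
        fix i assume i: "i \<in> {0..n * a} - {n}"
        then consider "i < n" | "n < i" by fastforce
        then show "(f - g) $ i * (x ^ i) $ (n * a) = 0"
          using fg order_ge_power(1)[OF assms(2), of i] assms(3) by cases auto
      qed
    qed (use assms in auto)
    also have "\<dots> = (f $ n - g $ n) * (x $ a) ^ n"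
      using order_ge_power(2)[OF assms(2), of n] by simp
    finally have "(f oo x) $ (n * a) = (g oo x) $ (n * a) + (f $ n - g $ n) * (x $ a) ^ n"
      by (simp add: fps_compose_sub_distrib algebra_simps)
    then show "\<Phi> f $ n = \<Phi> g $ n"
      using assms(1) by (simp add: \<Phi>_def field_simps)
  qed
  then obtain f where f: "\<Phi> f = f" ..
  have "(y - (f oo x)) $ (k * a) = 0" for k
  proof -
    have "(y - (f oo x)) $ (k * a) / (x $ a) ^ k = \<Phi> f $ k - f $ k"
      by (simp add: \<Phi>_def)
    also have "\<dots> = 0" by (simp only: f diff_self)
    finally show ?thesis using assms(1) by simp
  qed
  then show ?thesis by blast
qed

text \<open>
  After the subtraction of a power series in \<open>x\<close> the order of the second component is not a multiple of
  \<open>a\<close>. The second component does not become zero, because otherwise all orders would be multiples of \<open>a\<close>.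
\<close>

lemma normalise:
  assumes "order_ge a x" "x $ a \<noteq> 0" "2 \<le> a" "y = 0 \<or> a < subdegree y"
    and gaps: "finite (- semigroup_of (x, y))"
  shows "\<exists>b y'. branch x y' a b \<and> (x, y) \<sim>\<^sub>A (x, y') \<and>
    semigroup_of (x, y') = semigroup_of (x, y) \<and>
    (y \<noteq> 0 \<and> \<not> a dvd subdegree y \<longrightarrow> b = subdegree y)"
proof (cases "y \<noteq> 0 \<and> \<not> a dvd subdegree y")
  case True
  then have "branch x y a (subdegree y)"
    using assms by unfold_locales (auto intro: subdegreeI)
  then show ?thesis
    using A_equiv_refl[OF x_0 y_0] by (intro exI[of _ "subdegree y"] exI[of _ y]) simp
next
  case False
  obtain f where f: "\<And>k. (y - (f oo x)) $ (k * a) = 0"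
    using remove_powers_of_x[of a] assms by auto
  define y' where "y' = y - (f oo x)"
  have f0: "f $ 0 = 0" using f[of 0] by simp
  have eq: "y' = fps_const 1 * y + subst2 (- fps_const f) (x, y)"
    by (simp add: y'_def subst2_uminus fps_compose_uminus)
  have 1: "(x, y) \<sim>\<^sub>A (x, y')"
    unfolding eq by (rule A_equiv_change_snd) (use f0 in simp_all)
  have y'_0: "y' $ 0 = 0" using f0 by (simp add: y'_def)
  have sg: "semigroup_of (x, y') = semigroup_of (x, y)"
    by (rule semigroup_A_equiv[OF x_0 y_0 1])
  interpret new: plane_pair x y' by unfold_locales (use y'_0 in auto)
  have "y' \<noteq> 0"
  proof
    assume "y' = 0"
    have "a dvd n" if n: "n \<in> semigroup_of (x, y)" for n
    proof -
      obtain F where F: "n = subdegree (subst2 F (x, y'))"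
        using n unfolding sg[symmetric] semigroup_iff by (auto simp: new.ring_iff)
      have "subst2 F (x, y') = F $ 0 oo x"
        using new.subst2_expand_Y[of F] \<open>y' = 0\<close> by simp
      moreover have "subdegree x = a" using assms by (auto intro: subdegreeI)
      ultimately show ?thesis by (simp add: F)
    qed
    moreover have "\<not> a dvd k * a + 1" for k
      using assms(3) by (subst dvd_add_right_iff) auto
    ultimately have "range (\<lambda>k. k * a + 1) \<subseteq> - semigroup_of (x, y)"
      by blast
    moreover have "infinite (range (\<lambda>k. k * a + 1))"
      using assms(3) by (intro range_inj_infinite) (auto simp: inj_def)
    ultimately show False using gaps finite_subset by blast
  qed
  define b where "b = subdegree y'"
  have "order_ge a y"
    using assms(4) by (auto intro: nth_less_subdegree_zero)
  moreover have "order_ge a (f oo x)"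
    using order_ge_mult(1)[OF assms(1), of 0 "fps_shift 1 f oo x"] compose_expand[of f] f0 by simp
  ultimately have "order_ge a y'" by (simp add: y'_def)
  then have "a \<le> b"
    using \<open>y' \<noteq> 0\<close> by (simp add: b_def order_ge_iff_subdegree)
  have ndvd: "\<not> a dvd b"
  proof
    assume "a dvd b"
    then obtain k where "b = k * a" by (metis dvd_div_mult_self)
    then have "y' $ b = 0" using f[of k] by (simp add: y'_def)
    then show False using \<open>y' \<noteq> 0\<close> by (simp add: b_def)
  qed
  moreover have "a \<noteq> b" using ndvd by auto
  ultimately have "branch x y' a b"
    using assms \<open>a \<le> b\<close> \<open>y' \<noteq> 0\<close> sg
    by unfold_locales (auto intro: subdegreeI simp: b_def)
  then show ?thesis using 1 sg False by blast
qed

end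

lemma smooth_normal_form:
  fixes x y :: "'k::alg_closed_field fps"
  assumes "x $ 0 = 0" "y $ 0 = 0" "x $ 1 \<noteq> 0" "0 < b"
  shows "(x, y) \<sim>\<^sub>A (fps_X ^ 1, fps_X ^ b)"
proof -
  obtain r where r: "r $ 0 = 0" "r $ 1 \<noteq> 0" "x oo r = fps_X ^ 1"
    using reparam_to_power[of x 1] assms by auto
  have 1: "(x, y) \<sim>\<^sub>A (fps_X, y oo r)"
    using A_equiv_reparam[OF assms(1,2) r(1,2)] r(3) by simp
  interpret plane_pair fps_X "y oo r" by unfold_locales (use assms in auto)
  have "(fps_X, y oo r) \<sim>\<^sub>A
      (fps_X, fps_const 1 * (y oo r) + subst2 (fps_const (fps_X ^ b - (y oo r))) (fps_X, y oo r))"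
    by (rule A_equiv_change_snd) (use assms in auto)
  then have 2: "(fps_X, y oo r) \<sim>\<^sub>A (fps_X, fps_X ^ b)" by (simp add: assms)
  show ?thesis using A_equiv_trans[OF assms(1,2) 1 2] by simp
qed

theorem theorem3p1:
  fixes x y :: "'k::alg_closed_field fps"
    and a c p :: nat and \<Gamma> :: "nat set"
  assumes "p = CHAR('k)"
    and "parameterization (x, y)" and "primitive (x, y)"
    and "\<Gamma> = semigroup_of (x, y)" and "c = conductor \<Gamma>"
    and "x \<noteq> 0" and "a = subdegree x" and "y = 0 \<or> a < subdegree y"
  shows "\<exists>b. a < b \<and>
    (y \<noteq> 0 \<and> (a = 1 \<or> \<not> a dvd subdegree y) \<longrightarrow> b = subdegree y) \<and>
    \<comment> \<open>(1)\<close>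
    (\<exists>\<alpha> \<beta>. (x, y) \<sim>\<^sub>A (fps_X ^ a + series_on {i. a < i \<and> i \<notin> \<Gamma>} \<alpha>,
                      fps_X ^ b + series_on {i. b < i \<and> i \<notin> \<Gamma>} \<beta>)) \<and>
    (a \<noteq> 1 \<longrightarrow> \<not> a dvd b) \<and>
    (\<not> p dvd a \<longrightarrow>
      (\<exists>\<beta>. (x, y) \<sim>\<^sub>A (fps_X ^ a, fps_X ^ b + series_on {i. b < i \<and> i \<notin> \<Gamma>} \<beta>))) \<and>
    (\<not> p dvd b \<longrightarrow>
      (\<exists>\<alpha>. (x, y) \<sim>\<^sub>A (fps_X ^ a + series_on {i. a < i \<and> i \<notin> \<Gamma>} \<alpha>, fps_X ^ b))) \<and>
    \<comment> \<open>(2)\<close>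
    (a > 2 \<and> \<not> p dvd b \<longrightarrow>
      (\<exists>\<alpha> \<beta>. (x, y) \<sim>\<^sub>A (fps_X ^ a + series_on {i. a < i \<and> i \<notin> \<Gamma>} \<alpha>,
                        fps_X ^ b + series_on {i. b < i \<and> i \<notin> \<Gamma> \<and> i < c - 1} \<beta>))) \<and>
    (a > 2 \<and> \<not> p dvd a \<longrightarrow>
      (\<exists>\<alpha> \<beta>. (x, y) \<sim>\<^sub>A (fps_X ^ a + series_on {i. a < i \<and> i \<notin> \<Gamma> \<and> i < c - 1} \<alpha>,
                        fps_X ^ b + series_on {i. b < i \<and> i \<notin> \<Gamma>} \<beta>))) \<and>
    \<comment> \<open>(3)\<close>
    (a > 2 \<and> \<not> p dvd a \<and> \<not> p dvd b \<longrightarrow>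
      (\<exists>\<alpha> \<beta>. (x, y) \<sim>\<^sub>A (fps_X ^ a, fps_X ^ b + series_on {i. b < i \<and> i \<notin> \<Gamma> \<and> i < c - 1} \<beta>) \<and>
             (fps_X ^ a, fps_X ^ b + series_on {i. b < i \<and> i \<notin> \<Gamma> \<and> i < c - 1} \<beta>) \<sim>\<^sub>A
             (fps_X ^ a + series_on {i. a < i \<and> i \<notin> \<Gamma> \<and> i < c - 1} \<alpha>, fps_X ^ b)))"
proof -
  interpret plane_pair x y
    by unfold_locales (use assms(2) in \<open>auto simp: parameterization_def\<close>)
  have ox: "order_ge a x" "x $ a \<noteq> 0"
    using assms(6,7) by (auto intro: nth_less_subdegree_zero)
  have gaps: "finite (- semigroup_of (x, y))"
    by (rule finite_gaps_if_primitive[OF assms(3)])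
  have zero: "series_on S (\<lambda>_. 0) = (0 :: 'k fps)" for S
    by (simp add: series_on_def fps_eq_iff)
  have "a \<noteq> 0" using ox(2) x_0 by metis
  then consider "a = 1" | "2 \<le> a" by linarith
  then show ?thesis
  proof cases
    case 1
    define b where "b = (if y = 0 then 2 else subdegree y)"
    have b: "a < b" "y \<noteq> 0 \<longrightarrow> b = subdegree y"
      using assms(8) 1 by (auto simp: b_def)
    have "(x, y) \<sim>\<^sub>A (fps_X ^ a, fps_X ^ b)"
      using smooth_normal_form[of x y b] ox b 1 by simp
    then have "(x, y) \<sim>\<^sub>A (fps_X ^ a + series_on S (\<lambda>_. 0), fps_X ^ b + series_on S' (\<lambda>_. 0))"
        "(x, y) \<sim>\<^sub>A (fps_X ^ a, fps_X ^ b + series_on S' (\<lambda>_. 0))"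
        "(x, y) \<sim>\<^sub>A (fps_X ^ a + series_on S (\<lambda>_. 0), fps_X ^ b)" for S S'
      by (simp_all add: zero)
    then show ?thesis using b 1 by (intro exI[of _ b]) (simp, blast)
  next
    case 2
    obtain b y' where br: "branch x y' a b" and xy': "(x, y) \<sim>\<^sub>A (x, y')"
      and sg: "semigroup_of (x, y') = \<Gamma>" and b: "y \<noteq> 0 \<and> \<not> a dvd subdegree y \<longrightarrow> b = subdegree y"
      using normalise[OF ox 2 assms(8) gaps] assms(4) by blast
    interpret normal: branch_closed x y' a b
      by (intro branch_closed.intro br)
    note trans = A_equiv_trans[OF x_0 y_0 xy']
    have char: "\<not> p dvd n \<Longrightarrow> of_nat n \<noteq> (0 :: 'k)" for n
      by (simp add: assms(1) of_nat_eq_0_iff_char_dvd)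
    have 10: "\<exists>\<alpha> \<beta>. (x, y) \<sim>\<^sub>A (fps_X ^ a + series_on {i. a < i \<and> i \<notin> \<Gamma>} \<alpha>,
                      fps_X ^ b + series_on {i. b < i \<and> i \<notin> \<Gamma>} \<beta>)"
      using normal.normal_form trans unfolding sg by blast
    have 11: "\<exists>\<beta>. (x, y) \<sim>\<^sub>A (fps_X ^ a, fps_X ^ b + series_on {i. b < i \<and> i \<notin> \<Gamma>} \<beta>)" if "\<not> p dvd a"
      using normal.normal_form_power_fst[OF char[OF that]] trans unfolding sg by blast
    have 12: "\<exists>\<alpha>. (x, y) \<sim>\<^sub>A (fps_X ^ a + series_on {i. a < i \<and> i \<notin> \<Gamma>} \<alpha>, fps_X ^ b)" if "\<not> p dvd b"
      using normal.normal_form_power_snd[OF char[OF that]] trans unfolding sg by blast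
    \<comment> \<open>In part (2) the shortened sum may be taken to be zero, because the component can be made a pure power.\<close>
    have 21: "\<exists>\<alpha> \<beta>. (x, y) \<sim>\<^sub>A (fps_X ^ a + series_on {i. a < i \<and> i \<notin> \<Gamma>} \<alpha>,
                        fps_X ^ b + series_on {i. b < i \<and> i \<notin> \<Gamma> \<and> i < c - 1} \<beta>)" if nb: "\<not> p dvd b"
    proof -
      obtain \<alpha> where "(x, y) \<sim>\<^sub>A (fps_X ^ a + series_on {i. a < i \<and> i \<notin> \<Gamma>} \<alpha>, fps_X ^ b)"
        using 12[OF nb] by blast
      then show ?thesis
        by (intro exI[of _ \<alpha>] exI[of _ "\<lambda>_. 0"]) (simp add: zero)
    qed
    have 22: "\<exists>\<alpha> \<beta>. (x, y) \<sim>\<^sub>A (fps_X ^ a + series_on {i. a < i \<and> i \<notin> \<Gamma> \<and> i < c - 1} \<alpha>,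
                        fps_X ^ b + series_on {i. b < i \<and> i \<notin> \<Gamma>} \<beta>)" if na: "\<not> p dvd a"
    proof -
      obtain \<beta> where "(x, y) \<sim>\<^sub>A (fps_X ^ a, fps_X ^ b + series_on {i. b < i \<and> i \<notin> \<Gamma>} \<beta>)"
        using 11[OF na] by blast
      then show ?thesis
        by (intro exI[of _ "\<lambda>_. 0"] exI[of _ \<beta>]) (simp add: zero)
    qed
    have 3: "\<exists>\<alpha> \<beta>. (x, y) \<sim>\<^sub>A (fps_X ^ a, fps_X ^ b + series_on {i. b < i \<and> i \<notin> \<Gamma> \<and> i < c - 1} \<beta>) \<and>
             (fps_X ^ a, fps_X ^ b + series_on {i. b < i \<and> i \<notin> \<Gamma> \<and> i < c - 1} \<beta>) \<sim>\<^sub>A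
             (fps_X ^ a + series_on {i. a < i \<and> i \<notin> \<Gamma> \<and> i < c - 1} \<alpha>, fps_X ^ b)"
      if "\<not> p dvd a" "\<not> p dvd b"
      using normal.both_short_normal_forms[OF char[OF that(1)] char[OF that(2)]] trans
      unfolding sg assms(5)[symmetric] by blast
    show ?thesis
      by (rule exI[of _ b])
        (use normal.a_less_b normal.a_ndvd_b b 2 10 11 12 21 22 3 in \<open>intro conjI impI; (elim conjE)?; simp\<close>)
  qed
qed

end
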